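(* For every integer $n\ge 3$ there is a $\delta=\delta(n)>0$ with the following property. Let $B$ be a convex body in $\mathbb{R}^n$ such that $1\neq d_{BM}(B,B_\infty^n)\le 1+\delta$. Then $B$ can be illuminated with at most $2^n-1$ directions, i.e. $\mathcal{I}(B)\le 2^n-1$.
   Context: A convex body in $\mathbb{R}^n$ is a compact convex set with non-empty interior; $\partial B$ is the boundary of $B$. $B_\infty^n=[-1,1]^n$ is the closed unit ball of the $\ell_\infty$-norm. Illumination: a point $x\in\partial B$ is illuminated in direction $y\in\mathbb{R}^n\setminus\{0\}$ if there is an (arbitrarily small) $t>0$ such that $x+ty$ lies in the interior of $B$. A collection $\{y^1,\dots,y^m\}$ of non-zero vectors illuminates $B$ if every $x\in\partial B$ is illuminated in direction $y^i$ for some $i=i(x)\le m$. $\mathcal{I}(B)$ denotes the smallest cardinality of a set of directions illuminating $B$. Banach--Mazur distance: for (not necessarily centrally symmetric) convex bodies $B,L\subset\mathbb{R}^n$, $d_{BM}(B,L)$ is the infimum of all $\lambda\ge 1$ for which there are an invertible linear operator $T:\mathbb{R}^n\to\mathbb{R}^n$ and vectors $x,y\in\mathbb{R}^n$ with $B\subset T(L)+x\subset \lambda B+y$. *)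

theory Defs
  imports "HOL-Analysis.Analysis" "HOL-Library.Extended_Nat"
begin

definition convex_body :: "'a::euclidean_space set \<Rightarrow> bool" where
  "convex_body B \<longleftrightarrow> compact B \<and> convex B \<and> interior B \<noteq> {}"

definition cube_body :: "(real ^ 'n) set" where
  "cube_body = cbox (- 1) 1"

(* Points of the interior are required at arbitrarily small t > 0. For convex B and x in B
   this is the same as requiring a single such t. *)
definition illuminated_in_direction ::
  "'a::euclidean_space set \<Rightarrow> 'a \<Rightarrow> 'a \<Rightarrow> bool" where
  "illuminated_in_direction B x y \<longleftrightarrow>
     y \<noteq> 0 \<and> (\<forall>e>0. \<exists>t. 0 < t \<and> t < e \<and> x + t *\<^sub>R y \<in> interior B)"

definition illuminates :: "'a::euclidean_space set \<Rightarrow> 'a set \<Rightarrow> bool" where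
  "illuminates D B \<longleftrightarrow>
     finite D \<and> 0 \<notin> D \<and> (\<forall>x\<in>frontier B. \<exists>y\<in>D. illuminated_in_direction B x y)"

(* Valued in enat so that the infimum is infinite, rather than 0, for a set B that no finite
   set of directions illuminates. *)
definition illumination_number :: "'a::euclidean_space set \<Rightarrow> enat" where
  "illumination_number B = (INF D \<in> {D. illuminates D B}. enat (card D))"

(* For convex bodies B and L the set below is nonempty, so the real infimum is the genuine one. *)
definition banach_mazur_dist ::
  "'a::euclidean_space set \<Rightarrow> 'a set \<Rightarrow> real" where
  "banach_mazur_dist B L =
     Inf {l. 1 \<le> l \<and> (\<exists>T x y. linear T \<and> bij T \<and>
            B \<subseteq> (\<lambda>z. T z + x) ` L \<and>
            (\<lambda>z. T z + x) ` L \<subseteq> (\<lambda>z. l *\<^sub>R z + y) ` B)}"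

end

theory Submission
  imports Defs
begin

text \<open>
  After an affine map, \<open>(1 - \<epsilon>)Q \<subseteq> B \<subseteq> Q\<close> for the cube \<open>Q\<close>. Where the \<open>k\<close>-th coordinate axis leaves
  \<open>B\<close> in direction \<open>\<sigma> = \<plusminus>1\<close>, take a supporting half-space \<open>a k \<sigma> \<bullet> x \<le> r k \<sigma>\<close>; the \<open>2n\<close> half-spaces
  form a polytope \<open>P \<supseteq> B\<close> that is combinatorially a cube. Two quantities measure how far \<open>B\<close> is
  from being a parallelotope: the tilts \<open>a k 1 + a k (-1)\<close> of opposite facets of \<open>P\<close>, and \<open>\<eta>\<close>, the
  largest distance (in facet coordinates) of a vertex of \<open>P\<close> to \<open>B\<close>. If both vanish then \<open>B = P\<close> is
  a parallelotope.

  Every vertex region is illuminated by its own direction \<open>-v\<close>, and one direction has to be saved.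
  Let \<open>beam v i s\<close> be nearly parallel to facets \<open>\<plusminus>i\<close> and agree with \<open>-v\<close> in all other coordinates.
  If some tilt is not small compared with \<open>\<eta>\<close>, a single such beam illuminates two adjacent vertex
  regions at once. Otherwise \<open>\<eta> > 0\<close>, and the region of the vertex farthest from \<open>B\<close> is
  illuminated by beams belonging to its \<open>n\<close> neighbours: every point there misses some facet \<open>k\<close> by at
  least \<open>\<eta>\<close>, which leaves room for a small positive \<open>k\<close>-th component.
\<close>

section \<open>Illumination and outer normals\<close>

text \<open>No length is prescribed, so that a normal can later be rescaled to make one chosen
  coordinate equal to a sign.\<close>

definition outer_normal :: "'a::euclidean_space set \<Rightarrow> 'a \<Rightarrow> 'a \<Rightarrow> bool" where
  "outer_normal B x \<nu> \<longleftrightarrow> \<nu> \<noteq> 0 \<and> (\<forall>z\<in>B. \<nu> \<bullet> z \<le> \<nu> \<bullet> x)"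

lemma outer_normal_interior:
  assumes "outer_normal B x \<nu>" "z \<in> interior B"
  shows "\<nu> \<bullet> z < \<nu> \<bullet> x"
proof -
  have n: "\<nu> \<noteq> 0" using assms(1) by (simp add: outer_normal_def)
  obtain e where e: "e > 0" "cball z e \<subseteq> B"
    using assms(2) mem_interior_cball by blast
  have "z + (e / norm \<nu>) *\<^sub>R \<nu> \<in> cball z e"
    using e n by (simp add: dist_norm)
  then have "\<nu> \<bullet> (z + (e / norm \<nu>) *\<^sub>R \<nu>) \<le> \<nu> \<bullet> x"
    using assms(1) e by (auto simp: outer_normal_def)
  moreover have "(e / norm \<nu>) * (\<nu> \<bullet> \<nu>) > 0" using e n by simp
  ultimately show ?thesis by (simp add: inner_right_distrib)
qed

text \<open>One time suffices: points strictly between an interior point and a point of a convex set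
  are interior, so all shorter times work as well.\<close>

lemma illuminated_in_directionI:
  fixes B :: "'a::euclidean_space set"
  assumes "convex B" "x \<in> B" "y \<noteq> 0" "t > 0" "x + t *\<^sub>R y \<in> interior B"
  shows "illuminated_in_direction B x y"
  unfolding illuminated_in_direction_def
proof (intro conjI allI impI)
  fix e :: real assume e: "e > 0"
  show "\<exists>t. 0 < t \<and> t < e \<and> x + t *\<^sub>R y \<in> interior B"
  proof (cases "t < e")
    case True then show ?thesis using assms by blast
  next
    case False
    let ?u = "e / 2"
    have u: "0 < ?u" "?u < t" "?u < e" using False e by auto
    have "x + ?u *\<^sub>R y = (1 - (1 - ?u / t)) *\<^sub>R (x + t *\<^sub>R y) + (1 - ?u / t) *\<^sub>R x"
      using \<open>t > 0\<close> by (simp add: algebra_simps)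
    moreover have "x + t *\<^sub>R y \<noteq> x" using assms by simp
    moreover have "0 < 1 - ?u / t" "1 - ?u / t < 1" using u \<open>t > 0\<close> by (auto simp: field_simps)
    ultimately have "x + ?u *\<^sub>R y \<in> open_segment (x + t *\<^sub>R y) x"
      unfolding in_segment by blast
    then have "x + ?u *\<^sub>R y \<in> interior B"
      using in_interior_closure_convex_segment[OF assms(1,5), of x] assms(2) closure_subset by blast
    then show ?thesis using u by blast
  qed
qed (use assms in auto)

text \<open>If the open ray from \<open>x\<close> along \<open>y\<close> missed the interior, a
  hyperplane separating the two would yield an outer normal at \<open>x\<close> with nonnegative
  product with \<open>y\<close>.\<close>

lemma illuminated_if_normals:
  fixes B :: "'a::euclidean_space set"
  assumes "convex B" "interior B \<noteq> {}" "x \<in> B" "y \<noteq> 0"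
    and "\<And>\<nu>. outer_normal B x \<nu> \<Longrightarrow> \<nu> \<bullet> y < 0"
  shows "illuminated_in_direction B x y"
proof (rule ccontr)
  assume no: "\<not> ?thesis"
  let ?T = "(\<lambda>t. x + t *\<^sub>R y) ` {0<..}"
  have "interior B \<inter> ?T = {}"
    using no illuminated_in_directionI[OF assms(1,3,4)] by auto
  moreover have "convex ?T"
  proof -
    have "?T = (+) x ` ((\<lambda>t. t *\<^sub>R y) ` {0<..})" by (auto simp: image_image)
    moreover have "convex ((\<lambda>t. t *\<^sub>R y) ` {0::real<..})"
      by (rule convex_linear_image) (auto simp: linear_iff algebra_simps)
    ultimately show ?thesis by (metis convex_translation)
  qed
  moreover have "?T \<noteq> {}" by auto
  ultimately obtain a b where ab: "a \<noteq> 0" "\<forall>z\<in>interior B. a \<bullet> z \<le> b" "\<forall>z\<in>?T. b \<le> a \<bullet> z"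
    using separating_hyperplane_sets[of "interior B" ?T] assms(1,2) convex_interior by blast
  have le: "b \<le> a \<bullet> x + t * (a \<bullet> y)" if "t > 0" for t
    using ab(3) that by (auto simp: inner_right_distrib)
  have "B \<subseteq> closure (interior B)"
    using assms(1,2) closure_subset convex_closure_interior by blast
  then have B: "a \<bullet> z \<le> b" if "z \<in> B" for z
    using that ab(2) closure_minimal[of "interior B" "{z. a \<bullet> z \<le> b}"] closed_halfspace_le[of a b]
    by auto
  \<comment> \<open>Letting the ray parameter tend to 0 shows that the separating hyperplane passes
    through \<open>x\<close>.\<close>
  have "b \<le> a \<bullet> x"
  proof (rule field_le_epsilon)
    fix e :: real assume e: "e > 0"
    let ?t = "e / (\<bar>a \<bullet> y\<bar> + 1)"
    have t: "?t > 0" using e by simp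
    have "?t * (a \<bullet> y) \<le> ?t * (\<bar>a \<bullet> y\<bar> + 1)"
      using t by (intro mult_left_mono) auto
    also have "\<dots> = e" by simp
    finally show "b \<le> a \<bullet> x + e" using le[OF t] by linarith
  qed
  then have "outer_normal B x a" using ab(1) B by (force simp: outer_normal_def)
  from assms(5)[OF this] B[OF assms(3)] le[of 1] show False by simp
qed

section \<open>Affine invariance of illumination\<close>

lemma illuminated_affine_image:
  fixes B :: "'a::euclidean_space set"
  assumes T: "linear T" "bij T" and "illuminated_in_direction B x y"
  shows "illuminated_in_direction ((\<lambda>z. T z + c) ` B) (T x + c) (T y)"
proof -
  have i: "interior ((\<lambda>z. T z + c) ` B) = (\<lambda>z. T z + c) ` interior B"
  proof -
    have e: "(\<lambda>z. T z + c) ` S = (+) c ` (T ` S)" for S by (auto simp: image_image add.commute)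
    show ?thesis unfolding e interior_translation
      using interior_bijective_linear_image[OF T] by simp
  qed
  have "T y \<noteq> 0"
    using assms by (metis bij_is_inj illuminated_in_direction_def injD linear_0)
  moreover have "T x + c + t *\<^sub>R T y = T (x + t *\<^sub>R y) + c" for t
    using T by (simp add: linear_add linear_scale)
  ultimately show ?thesis
    using assms(3) unfolding illuminated_in_direction_def i by (metis imageI)
qed

lemma illuminates_affine_image:
  fixes B :: "'a::euclidean_space set"
  assumes T: "linear T" "bij T" and "illuminates D B"
  shows "illuminates (T ` D) ((\<lambda>z. T z + c) ` B)"
proof -
  have e: "(\<lambda>z. T z + c) ` S = (+) c ` (T ` S)" for S by (auto simp: image_image add.commute)
  have "frontier ((\<lambda>z. T z + c) ` B) = (\<lambda>z. T z + c) ` frontier B"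
    unfolding e frontier_translation
    using T by (simp add: frontier_def interior_bijective_linear_image closure_injective_linear_image
        bij_is_inj image_set_diff)
  moreover have "0 \<notin> T ` D"
    using assms by (metis (no_types, lifting) bij_is_inj illuminates_def image_iff injD linear_0)
  ultimately show ?thesis
    using assms(3) illuminated_affine_image[OF T] unfolding illuminates_def by fastforce
qed

section \<open>Sign vectors and beams\<close>

definition sign_vectors :: "(real ^ 'n) set" where
  "sign_vectors = {v. \<forall>j. v $ j = 1 \<or> v $ j = -1}"

definition flip :: "real ^ 'n \<Rightarrow> 'n \<Rightarrow> real ^ 'n" where
  "flip v i = (\<chi> j. if j = i then - v $ j else v $ j)"

definition beam :: "real ^ 'n \<Rightarrow> 'n \<Rightarrow> real \<Rightarrow> real ^ 'n" where
  "beam v i s = (\<chi> j. if j = i then s * v $ i else - v $ j)"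

definition sign_of :: "real ^ 'n \<Rightarrow> real ^ 'n" where
  "sign_of x = (\<chi> j. if 0 \<le> x $ j then 1 else -1)"

lemma sign_vectors_cases: "v \<in> sign_vectors \<Longrightarrow> v $ j = 1 \<or> v $ j = -1"
  by (simp add: sign_vectors_def)

lemma sign_vectors_square: "v \<in> sign_vectors \<Longrightarrow> v $ j * v $ j = 1"
  using sign_vectors_cases[of v j] by auto

lemma flip_component: "flip v i $ j = (if j = i then - v $ j else v $ j)"
  by (simp add: flip_def)

lemma beam_component: "beam v i s $ j = (if j = i then s * v $ i else - v $ j)"
  by (simp add: beam_def)

lemma flip_in_sign_vectors: "v \<in> sign_vectors \<Longrightarrow> flip v i \<in> sign_vectors"
  by (auto simp: sign_vectors_def flip_component)

lemma sign_of_in_sign_vectors: "sign_of x \<in> sign_vectors"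
  by (simp add: sign_vectors_def sign_of_def)

lemma sign_of_nonneg: "0 \<le> sign_of x $ j * x $ j"
  by (simp add: sign_of_def)

lemma flip_flip: "flip (flip v i) i = v"
  by (simp add: flip_def vec_eq_iff)

lemma beam_one: "beam v i 1 = - flip v i"
  by (simp add: flip_def beam_def vec_eq_iff)

text \<open>One vector is a beam for both end points of an edge; this sharing is what saves a
  direction later.\<close>

lemma beam_flip: "beam (flip v i) i s = beam v i (- s)"
  by (simp add: flip_def beam_def vec_eq_iff)

lemma beam_eq: "beam v i s = - v + axis i ((1 + s) * v $ i)"
  by (simp add: beam_def vec_eq_iff axis_def algebra_simps)

lemma flip_neq: "v \<in> sign_vectors \<Longrightarrow> flip v i \<noteq> v"
  using sign_vectors_cases[of v i] by (auto simp: vec_eq_iff flip_component intro!: exI[of _ i])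

lemma inj_flip: "v \<in> sign_vectors \<Longrightarrow> inj (flip v)"
  by (rule injI) (metis flip_flip flip_neq flip_component vec_eq_iff)

text \<open>Vertices two flips away from \<open>v\<close> are neither \<open>v\<close> nor a
  neighbour of it, so their opposite directions stay available when \<open>v\<close> and its
  neighbours receive special ones.\<close>

lemma flip_flip_neq:
  assumes "v \<in> sign_vectors" "i \<noteq> j"
  shows "flip (flip v i) j \<noteq> v" "flip (flip v i) j \<noteq> flip v k"
proof -
  have "flip (flip v i) j $ i \<noteq> v $ i" "flip (flip v i) j $ j \<noteq> v $ j"
    using assms sign_vectors_cases[OF assms(1), of i] sign_vectors_cases[OF assms(1), of j]
    by (auto simp: flip_component)
  then show "flip (flip v i) j \<noteq> v" "flip (flip v i) j \<noteq> flip v k"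
    using assms(2) flip_component by (metis, metis)
qed

lemma beam_nonzero:
  fixes v :: "real ^ 'n"
  assumes "v \<in> sign_vectors" "CARD('n) \<ge> 2"
  shows "beam v i s \<noteq> 0"
proof -
  obtain j where "j \<noteq> i"
    using assms(2) by (metis card_2_iff' ex_card UNIV_I)
  then have "beam v i s $ j \<noteq> 0"
    using sign_vectors_cases[OF assms(1), of j] by (auto simp: beam_component)
  then show ?thesis by force
qed

lemma card_sign_vectors:
  shows "finite (sign_vectors :: (real ^ 'n) set)"
    and "card (sign_vectors :: (real ^ 'n) set) = 2 ^ CARD('n)"
proof -
  let ?f = "\<lambda>A::'n set. (\<chi> j. if j \<in> A then 1 else -1) :: real ^ 'n"
  have "bij_betw ?f (Pow UNIV) sign_vectors"
  proof (rule bij_betwI[where g = "\<lambda>v. {j. v $ j = 1}"])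
    show "?f \<in> Pow UNIV \<rightarrow> sign_vectors" by (auto simp: sign_vectors_def)
    show "?f {j. v $ j = 1} = v" if "v \<in> sign_vectors" for v
      using sign_vectors_cases[OF that] by (force simp: vec_eq_iff)
  qed auto
  then show "finite (sign_vectors :: (real ^ 'n) set)"
    "card (sign_vectors :: (real ^ 'n) set) = 2 ^ CARD('n)"
    using bij_betw_finite bij_betw_same_card card_Pow[of "UNIV::'n set"] by fastforce+
qed

text \<open>A cube is the convex hull of its vertices; the substitution
  \<open>2 *\<^sub>R u - 1\<close> reduces this to the unit cube.\<close>

lemma cube_subset_convex:
  fixes S :: "(real ^ 'n) set"
  assumes "convex S" "sign_vectors \<subseteq> S"
  shows "cbox (- 1) 1 \<subseteq> S"
proof
  fix z :: "real ^ 'n" assume z: "z \<in> cbox (- 1) 1"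
  let ?S = "{u. 2 *\<^sub>R u - 1 \<in> S}"
  have "convex ?S"
  proof -
    have "?S = (\<lambda>u. 2 *\<^sub>R u) -` ((+) 1 ` S)"
      by (auto simp: image_iff algebra_simps intro!: bexI[of _ "_ - 1"])
    moreover have "linear (\<lambda>u::real ^ 'n. 2 *\<^sub>R u)" by (simp add: linear_iff algebra_simps)
    ultimately show ?thesis
      using convex_linear_vimage convex_translation[OF assms(1)] by metis
  qed
  moreover have "{x. \<forall>i. x $ i = 0 \<or> x $ i = 1} \<subseteq> ?S"
  proof
    fix x :: "real ^ 'n" assume x: "x \<in> {x. \<forall>i. x $ i = 0 \<or> x $ i = 1}"
    have "(2 *\<^sub>R x - 1) $ j = 1 \<or> (2 *\<^sub>R x - 1) $ j = -1" for j
      using x by (auto dest: spec[of _ j])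
    then have "2 *\<^sub>R x - 1 \<in> sign_vectors" by (simp add: sign_vectors_def)
    then show "x \<in> ?S" using assms(2) by auto
  qed
  ultimately have "convex hull {x. \<forall>i. x $ i = 0 \<or> x $ i = 1} \<subseteq> ?S"
    by (intro hull_minimal)
  moreover have "cbox (0 :: real ^ 'n) 1 = convex hull {x. \<forall>i. x $ i = 0 \<or> x $ i = 1}"
    unfolding Cart_1 unit_interval_convex_hull
    by (intro arg_cong[where f = "\<lambda>S. convex hull S"]) (simp add: Basis_vec_def inner_axis)
  ultimately have "cbox 0 1 \<subseteq> ?S" by simp
  moreover have "(1 / 2) *\<^sub>R (z + 1) \<in> cbox 0 1"
    unfolding mem_box_cart
  proof
    fix j
    have "-1 \<le> z $ j" "z $ j \<le> 1" using z by (auto simp: mem_box_cart)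
    then show "0 $ j \<le> ((1 / 2) *\<^sub>R (z + 1)) $ j \<and> ((1 / 2) *\<^sub>R (z + 1)) $ j \<le> 1 $ j"
      by simp
  qed
  ultimately have "2 *\<^sub>R ((1 / 2) *\<^sub>R (z + 1)) - 1 \<in> S" by blast
  then show "z \<in> S" by simp
qed

section \<open>Bodies close to the cube\<close>

text \<open>The smallness of \<epsilon> involves the dimension because errors from all coordinates
  are added up in \<open>weight_sum_bounds\<close>.\<close>

locale near_cube =
  fixes B :: "(real ^ 'n) set" and \<epsilon> :: real
  assumes convex_B: "convex B" and compact_B: "compact B"
    and inner: "(\<And>j. \<bar>x $ j\<bar> \<le> 1 - \<epsilon>) \<Longrightarrow> x \<in> B"
    and outer: "x \<in> B \<Longrightarrow> \<bar>x $ j\<bar> \<le> 1"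
    and \<epsilon>: "0 < \<epsilon>" "300 * real CARD('n) * \<epsilon> \<le> 1"
    and card_ge_2: "CARD('n) \<ge> 2"
begin

lemma \<epsilon>_small: "600 * \<epsilon> \<le> 1"
proof -
  have "300 * 2 * \<epsilon> \<le> 300 * real CARD('n) * \<epsilon>"
    using card_ge_2 \<epsilon>(1) by (intro mult_right_mono) auto
  then show ?thesis using \<epsilon>(2) by linarith
qed

lemma in_interior:
  assumes "\<And>j. \<bar>x $ j\<bar> < 1 - \<epsilon>"
  shows "x \<in> interior B"
proof -
  let ?U = "box (- (\<chi> j. 1 - \<epsilon>)) (\<chi> j. 1 - \<epsilon>) :: (real ^ 'n) set"
  have "?U \<subseteq> B"
  proof
    fix y assume y: "y \<in> ?U"
    have "- (1 - \<epsilon>) < y $ j \<and> y $ j < 1 - \<epsilon>" for j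
      using y unfolding mem_box_cart by (auto dest: spec[of _ j])
    then have "\<bar>y $ j\<bar> \<le> 1 - \<epsilon>" for j by (smt (verit, best))
    then show "y \<in> B" by (rule inner)
  qed
  moreover have "x \<in> ?U"
    unfolding mem_box_cart
  proof
    fix j
    show "(- (\<chi> j. 1 - \<epsilon>)) $ j < x $ j \<and> x $ j < (\<chi> j. 1 - \<epsilon>) $ j"
      using assms[of j] by auto
  qed
  ultimately show ?thesis using open_box interiorI by blast
qed

lemma interior_nonempty: "interior B \<noteq> {}"
  using in_interior[of 0] \<epsilon>_small by force

lemma sign_coordinate_le:
  assumes "x \<in> B" "v \<in> sign_vectors"
  shows "v $ j * x $ j \<le> 1"
  using outer[OF assms(1), of j] sign_vectors_cases[OF assms(2), of j] by auto

text \<open>In the orthant of \<open>v\<close> the signed coordinates of \<open>x\<close> lie in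
  [0,1]; the step shifts them to [-1/2,1/2], well within the inner cube.\<close>

lemma inward_half_step:
  assumes "x \<in> B" "v \<in> sign_vectors" "\<And>j. 0 \<le> v $ j * x $ j"
  shows "x + (1 / 2) *\<^sub>R (- v) \<in> interior B"
proof (rule in_interior)
  fix j
  show "\<bar>(x + (1 / 2) *\<^sub>R (- v)) $ j\<bar> < 1 - \<epsilon>"
    using assms(3)[of j] sign_vectors_cases[OF assms(2), of j] outer[OF assms(1), of j] \<epsilon>_small
    by auto
qed

lemma illuminated_by_opposite:
  assumes "x \<in> B" "v \<in> sign_vectors" "\<And>j. 0 \<le> v $ j * x $ j"
  shows "illuminated_in_direction B x (- v)"
proof (rule illuminated_in_directionI[where t = "1 / 2"])
  have "v $ undefined \<noteq> 0" using sign_vectors_cases[OF assms(2), of undefined] by auto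
  then show "- v \<noteq> 0" by force
qed (use assms convex_B inward_half_step in auto)

text \<open>At time \<open>2 * \<epsilon>\<close> the coordinates other than \<open>i\<close> have
  moved inward below \<open>1 - \<epsilon>\<close>, and coordinate \<open>i\<close> has room for any
  such \<open>s\<close>. Only points with all coordinates close to a vertex need finer
  arguments.\<close>

lemma illuminated_off_corner:
  assumes x: "x \<in> B" and v: "v \<in> sign_vectors" "\<And>j. 0 \<le> v $ j * x $ j"
    and s: "\<bar>s\<bar> \<le> 1" and i: "\<bar>x $ i\<bar> < 1 - 4 * \<epsilon>"
  shows "illuminated_in_direction B x (beam v i s)"
proof (rule illuminated_in_directionI[where t = "2 * \<epsilon>"])
  show "x + (2 * \<epsilon>) *\<^sub>R beam v i s \<in> interior B"
  proof (rule in_interior)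
    fix j
    show "\<bar>(x + (2 * \<epsilon>) *\<^sub>R beam v i s) $ j\<bar> < 1 - \<epsilon>"
    proof (cases "j = i")
      case True
      have "\<bar>2 * \<epsilon> * (s * v $ i)\<bar> = 2 * \<epsilon> * \<bar>s\<bar>"
        using \<epsilon> sign_vectors_cases[OF v(1), of i] by (auto simp: abs_mult)
      also have "\<dots> \<le> 2 * \<epsilon> * 1" using s \<epsilon> by (intro mult_left_mono) auto
      finally have "\<bar>2 * \<epsilon> * (s * v $ i)\<bar> \<le> 2 * \<epsilon>" by simp
      with True i \<epsilon> show ?thesis by (simp add: beam_component)
    next
      case False
      then show ?thesis
        using v(2)[of j] sign_vectors_cases[OF v(1), of j] outer[OF x, of j] \<epsilon> \<epsilon>_small
        by (auto simp: beam_component)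
    qed
  qed
qed (use x v convex_B \<epsilon> beam_nonzero card_ge_2 in auto)

text \<open>Take a supporting hyperplane at the last point of the half-axis in \<open>B\<close>.
  Since the inner cube lies on its correct side, the normal is almost parallel to the axis.\<close>

lemma support_on_axis:
  assumes \<sigma>: "\<sigma> = 1 \<or> \<sigma> = -1"
  shows "\<exists>a r. a $ i = \<sigma> \<and> (\<Sum>j\<in>UNIV - {i}. \<bar>a $ j\<bar>) \<le> 2 * \<epsilon> \<and> 1 - \<epsilon> \<le> r \<and> r \<le> 1 \<and>
           axis i (\<sigma> * r) \<in> B \<and> (\<forall>z\<in>B. a \<bullet> z \<le> r)"
proof -
  let ?S = "{t. axis i (\<sigma> * t) \<in> B}"
  have ax: "axis i (\<sigma> * t) = t *\<^sub>R axis i \<sigma>" for t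
    by (simp add: axis_def vec_eq_iff)
  have S0: "1 - \<epsilon> \<in> ?S"
    using \<sigma> \<epsilon>_small \<epsilon> by (auto intro!: inner simp: axis_def)
  have "closed ?S"
  proof -
    have "?S = (\<lambda>t. t *\<^sub>R axis i \<sigma>) -` B" by (auto simp: ax)
    moreover have "continuous_on UNIV (\<lambda>t. t *\<^sub>R axis i \<sigma> :: real ^ 'n)"
      by (intro continuous_intros)
    ultimately show ?thesis
      using closed_vimage compact_imp_closed[OF compact_B] by metis
  qed
  moreover have S1: "\<bar>t\<bar> \<le> 1" if "t \<in> ?S" for t
    using outer[of "axis i (\<sigma> * t)" i] that \<sigma> by (auto simp: axis_def)
  then have "bounded ?S" by (auto simp: bounded_iff)
  ultimately have "compact ?S" by (simp add: compact_eq_bounded_closed)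
  then obtain r where r: "r \<in> ?S" "\<And>t. t \<in> ?S \<Longrightarrow> t \<le> r"
    using compact_attains_sup[of ?S] S0 by blast
  let ?p = "axis i (\<sigma> * r)"
  have pB: "?p \<in> B" using r by simp
  have r1: "1 - \<epsilon> \<le> r" "r \<le> 1" using r S0 S1[of r] by auto
  have "?p \<notin> interior B"
  proof
    assume "?p \<in> interior B"
    then obtain e where e: "e > 0" "cball ?p e \<subseteq> B" using mem_interior_cball by blast
    have "norm (axis i \<sigma> :: real ^ 'n) = 1"
      using \<sigma> by (auto simp: norm_eq_sqrt_inner inner_axis_axis)
    then have "axis i (\<sigma> * (r + e)) \<in> cball ?p e"
      using e(1) by (simp only: ax mem_cball dist_norm scaleR_left_distrib) (simp)
    then have "r + e \<in> ?S" using e by auto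
    then show False using r(2) e(1) by force
  qed
  then have "?p \<notin> rel_interior B"
    using interior_nonempty rel_interior_nonempty_interior by blast
  then obtain \<nu> where \<nu>: "\<nu> \<noteq> 0" "\<And>y. y \<in> B \<Longrightarrow> \<nu> \<bullet> ?p \<le> \<nu> \<bullet> y"
    using supporting_hyperplane_rel_boundary[OF convex_B pB] by metis
  define \<mu> where "\<mu> = - \<nu>"
  have \<mu>: "\<mu> \<noteq> 0" "\<And>y. y \<in> B \<Longrightarrow> \<mu> \<bullet> y \<le> \<sigma> * r * \<mu> $ i"
    using \<nu> by (auto simp: \<mu>_def inner_axis mult.commute)
  \<comment> \<open>The vertex of the inner cube that maximises \<mu>: the product with it is
    \<open>1 - \<epsilon>\<close> times the 1-norm of \<mu>.\<close>
  define z where "z = (1 - \<epsilon>) *\<^sub>R sign_of \<mu>"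
  define R where "R = (\<Sum>j\<in>UNIV - {i}. \<bar>\<mu> $ j\<bar>)"
  have zB: "z \<in> B"
    using \<epsilon>_small \<epsilon> by (auto intro!: inner simp: z_def sign_of_def)
  have "\<mu> \<bullet> z = (\<Sum>j\<in>UNIV. (1 - \<epsilon>) * \<bar>\<mu> $ j\<bar>)"
    unfolding inner_vec_def by (intro sum.cong) (auto simp: z_def sign_of_def)
  also have "\<dots> = (1 - \<epsilon>) * (\<bar>\<mu> $ i\<bar> + R)"
    unfolding R_def sum_distrib_left[symmetric] by (subst sum.remove[of UNIV i]) auto
  finally have key: "(1 - \<epsilon>) * (\<bar>\<mu> $ i\<bar> + R) \<le> \<sigma> * r * \<mu> $ i"
    using \<mu>(2)[OF zB] by simp
  have R0: "R \<ge> 0" unfolding R_def by (intro sum_nonneg) auto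
  \<comment> \<open>Otherwise \<open>key\<close> would force the 1-norm of \<mu> to vanish.\<close>
  have pos: "\<sigma> * \<mu> $ i > 0"
  proof (rule ccontr)
    assume neg: "\<not> \<sigma> * \<mu> $ i > 0"
    moreover have "0 \<le> r" using r1 \<epsilon>_small by linarith
    ultimately have "r * (\<sigma> * \<mu> $ i) \<le> 0" by (meson mult_nonneg_nonpos not_less)
    then have "(1 - \<epsilon>) * (\<bar>\<mu> $ i\<bar> + R) \<le> 0" using key by (simp add: algebra_simps)
    then have "\<bar>\<mu> $ i\<bar> + R \<le> 0" using \<epsilon>_small by (simp add: mult_le_0_iff)
    then have z: "\<mu> $ i = 0" "R = 0" using R0 by auto
    then have "\<forall>j\<in>UNIV - {i}. \<bar>\<mu> $ j\<bar> = 0"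
      unfolding R_def by (subst (asm) sum_nonneg_eq_0_iff) auto
    with z have "\<mu> = 0" by (metis DiffI UNIV_I abs_eq_0 singletonD vec_eq_iff zero_index)
    then show False using \<mu> by simp
  qed
  define c where "c = \<sigma> * \<mu> $ i"
  have c: "c > 0" "\<bar>\<mu> $ i\<bar> = c" "\<mu> $ i = \<sigma> * c" using pos \<sigma> by (auto simp: c_def)
  have rc: "\<sigma> * r * \<mu> $ i = r * c" by (simp add: c_def)
  have "R \<le> 2 * \<epsilon> * c"
  proof -
    have "(1 - \<epsilon>) * (c + R) \<le> r * c" using key unfolding rc c(2) .
    also have "\<dots> \<le> 1 * c" using r1 c by (intro mult_right_mono) auto
    finally have *: "(1 - \<epsilon>) * R \<le> \<epsilon> * c" by (simp add: algebra_simps)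
    have "(1 / 2) * R \<le> (1 - \<epsilon>) * R" using \<epsilon>_small R0 by (intro mult_right_mono) auto
    then show ?thesis using * by simp
  qed
  let ?a = "(1 / c) *\<^sub>R \<mu>"
  have "?a $ i = \<sigma>" using c by simp
  moreover have "(\<Sum>j\<in>UNIV - {i}. \<bar>?a $ j\<bar>) \<le> 2 * \<epsilon>"
  proof -
    have "(\<Sum>j\<in>UNIV - {i}. \<bar>?a $ j\<bar>) = R / c"
      unfolding R_def sum_divide_distrib using c by (intro sum.cong) (auto simp: abs_mult)
    also have "\<dots> \<le> 2 * \<epsilon>"
      using \<open>R \<le> 2 * \<epsilon> * c\<close> c(1) by (simp add: pos_divide_le_eq)
    finally show ?thesis .
  qed
  moreover have "?a \<bullet> z \<le> r" if "z \<in> B" for z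
    using \<mu>(2)[OF that] c(1) unfolding rc by (simp add: field_simps)
  ultimately show ?thesis using r1 pB by blast
qed

end

section \<open>Tilt and vertex deficit\<close>

text \<open>Facets are indexed by a coordinate and a real sign, so that those meeting at the vertex
  \<open>v\<close> are \<open>a k (v $ k)\<close>. The values at other reals are irrelevant.\<close>

locale supported_near_cube = near_cube B \<epsilon>
  for B :: "(real ^ 'n) set" and \<epsilon> :: real +
  fixes a :: "'n \<Rightarrow> real \<Rightarrow> real ^ 'n" and r :: "'n \<Rightarrow> real \<Rightarrow> real"
  assumes a_diag: "\<sigma> = 1 \<or> \<sigma> = -1 \<Longrightarrow> a k \<sigma> $ k = \<sigma>"
    and a_off: "\<sigma> = 1 \<or> \<sigma> = -1 \<Longrightarrow> (\<Sum>j\<in>UNIV - {k}. \<bar>a k \<sigma> $ j\<bar>) \<le> 2 * \<epsilon>"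
    and r: "\<sigma> = 1 \<or> \<sigma> = -1 \<Longrightarrow> 1 - \<epsilon> \<le> r k \<sigma>" "\<sigma> = 1 \<or> \<sigma> = -1 \<Longrightarrow> r k \<sigma> \<le> 1"
    and contact: "\<sigma> = 1 \<or> \<sigma> = -1 \<Longrightarrow> axis k (\<sigma> * r k \<sigma>) \<in> B"
    and support: "\<sigma> = 1 \<or> \<sigma> = -1 \<Longrightarrow> z \<in> B \<Longrightarrow> a k \<sigma> \<bullet> z \<le> r k \<sigma>"
begin

lemma inner_diff_diag_le:
  assumes "\<sigma> = 1 \<or> \<sigma> = -1" "\<And>j. \<bar>z $ j\<bar> \<le> 1"
  shows "\<bar>a k \<sigma> \<bullet> z - \<sigma> * z $ k\<bar> \<le> 2 * \<epsilon>"
proof -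
  have "a k \<sigma> \<bullet> z - \<sigma> * z $ k = (\<Sum>j\<in>UNIV - {k}. a k \<sigma> $ j * z $ j)"
    unfolding inner_vec_def by (subst sum.remove[of UNIV k]) (auto simp: a_diag[OF assms(1)])
  also have "\<bar>\<dots>\<bar> \<le> (\<Sum>j\<in>UNIV - {k}. \<bar>a k \<sigma> $ j\<bar>)"
  proof (rule order_trans[OF sum_abs sum_mono])
    fix j
    show "\<bar>a k \<sigma> $ j * z $ j\<bar> \<le> \<bar>a k \<sigma> $ j\<bar>"
      using mult_left_mono[OF assms(2)[of j] abs_ge_zero[of "a k \<sigma> $ j"]] by (simp add: abs_mult)
  qed
  finally show ?thesis using a_off[OF assms(1), of k] by linarith
qed

lemma inner_beam:
  assumes "\<sigma> = 1 \<or> \<sigma> = -1"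
  shows "a k \<sigma> \<bullet> beam v k s = - (a k \<sigma> \<bullet> v) + (1 + s) * v $ k * \<sigma>"
  by (simp add: beam_eq inner_axis a_diag[OF assms] inner_diff_right)

end

text \<open>
  The linear programming core: \<open>\<beta>\<close> is the deviation of an outer normal from \<open>a i \<sigma>\<close>. The lower
  bound on \<open>\<Sum>\<beta>\<xi>\<close> comes from the contact point on the axis, the bounds on negative entries from
  points of \<open>B\<close> near the adjacent vertices. What matters is that the first loss carries a
  factor \<open>\<epsilon>\<close> and the second gain does not.
\<close>

lemma weight_sum_bounds:
  fixes \<beta> \<xi> :: "'n::finite \<Rightarrow> real" and \<epsilon> \<eta> d :: real
  assumes \<epsilon>: "0 \<le> \<epsilon>" "300 * real CARD('n) * \<epsilon> \<le> 1"
    and \<xi>: "\<And>j. 1 - 4 * \<epsilon> \<le> \<xi> j" "\<And>j. \<xi> j \<le> 1"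
    and d: "0 \<le> d" "d \<le> (\<Sum>j\<in>UNIV. \<beta> j * \<xi> j)" and \<eta>: "0 \<le> \<eta>"
    and neg: "\<And>j. \<beta> j < 0 \<Longrightarrow> - \<beta> j \<le> \<eta> + 6 * \<epsilon> * (\<Sum>k\<in>UNIV. \<bar>\<beta> k\<bar>)"
  shows "- 16 * CARD('n) * \<epsilon> * \<eta> \<le> (\<Sum>j\<in>UNIV. \<beta> j)"
    and "\<eta> \<le> d \<Longrightarrow> \<eta> / 2 \<le> (\<Sum>j\<in>UNIV. \<beta> j)"
proof -
  define N where "N = real CARD('n)"
  define S where "S = (\<Sum>j\<in>UNIV. \<beta> j)"
  define M where "M = (\<Sum>j\<in>UNIV. max 0 (- \<beta> j))"
  have N: "N \<ge> 1" unfolding N_def by (simp add: Suc_leI)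
  have NE: "300 * (N * \<epsilon>) \<le> 1" using \<epsilon> N_def by simp
  have M0: "M \<ge> 0" unfolding M_def by (intro sum_nonneg) auto
  have abs: "(\<Sum>k\<in>UNIV. \<bar>\<beta> k\<bar>) = S + 2 * M"
    unfolding S_def M_def sum_distrib_left sum.distrib[symmetric] by (intro sum.cong) auto
  have abs0: "0 \<le> S + 2 * M" unfolding abs[symmetric] by (intro sum_nonneg) auto
  \<comment> \<open>Summing \<open>neg\<close> bounds the negative mass \<open>M\<close> partly by
    itself, but with a coefficient of order \<open>N * \<epsilon>\<close>, so that it can be
    absorbed.\<close>
  have "M \<le> (\<Sum>j\<in>(UNIV::'n set). \<eta> + 6 * \<epsilon> * (S + 2 * M))"
    unfolding M_def
  proof (rule sum_mono)
    fix j :: 'n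
    show "max 0 (- \<beta> j) \<le> \<eta> + 6 * \<epsilon> * (S + 2 * (\<Sum>j\<in>UNIV. max 0 (- \<beta> j)))"
      using neg[of j] abs abs0 \<eta> \<epsilon> unfolding M_def[symmetric] by (cases "\<beta> j < 0") auto
  qed
  then have M1: "M \<le> N * \<eta> + 6 * (N * \<epsilon>) * (S + 2 * M)"
    by (simp add: N_def algebra_simps)
  \<comment> \<open>Replacing the weights \<xi> by 1 costs something only at negative entries, and
    there at most a fraction \<open>4 * \<epsilon>\<close>.\<close>
  have "(\<Sum>j\<in>UNIV. \<beta> j * \<xi> j) \<le> (\<Sum>j\<in>UNIV. \<beta> j + 4 * \<epsilon> * max 0 (- \<beta> j))"
  proof (rule sum_mono)
    fix j
    show "\<beta> j * \<xi> j \<le> \<beta> j + 4 * \<epsilon> * max 0 (- \<beta> j)"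
    proof (cases "\<beta> j < 0")
      case True
      then have "\<beta> j * \<xi> j \<le> \<beta> j * (1 - 4 * \<epsilon>)" using \<xi>(1)[of j] by (intro mult_left_mono_neg) auto
      then show ?thesis using True by (simp add: algebra_simps)
    next
      case False
      then have "\<beta> j * \<xi> j \<le> \<beta> j * 1" using \<xi>(2)[of j] by (intro mult_left_mono) auto
      then show ?thesis using False by simp
    qed
  qed
  also have "\<dots> = S + 4 * \<epsilon> * M"
    by (simp add: S_def M_def sum.distrib sum_distrib_left)
  finally have S1: "d - 4 * \<epsilon> * M \<le> S" using d(2) by linarith
  \<comment> \<open>For \<open>S > \<eta>\<close> both claims are immediate. Otherwise absorption
    gives \<open>M \<le> 2 * (N * \<eta>)\<close>.\<close>
  have small: "4 * \<epsilon> * M \<le> 8 * (N * \<epsilon> * \<eta>)" if S: "S \<le> \<eta>"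
  proof -
    have "6 * (N * \<epsilon>) * (S + 2 * M) \<le> 6 * (1 / 300) * (\<eta> + 2 * M)"
      using NE N \<epsilon> S abs0 by (intro mult_mono) auto
    with M1 have "M \<le> N * \<eta> + (\<eta> + 2 * M) / 50" by linarith
    moreover have "\<eta> \<le> N * \<eta>" using N \<eta> by (simp add: mult_le_cancel_right1)
    moreover have "M \<le> 2 * q" if "M \<le> q + (\<eta> + 2 * M) / 50" "\<eta> \<le> q" for q
      using that \<eta> by (simp add: field_simps)
    ultimately have "M \<le> 2 * (N * \<eta>)" by blast
    then have "4 * \<epsilon> * M \<le> 4 * \<epsilon> * (2 * (N * \<eta>))" using \<epsilon> by (intro mult_left_mono) auto
    then show ?thesis by (simp add: algebra_simps)
  qed
  have pos: "0 \<le> N * \<epsilon> * \<eta>" using N \<epsilon> \<eta> by simp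
  have pos2: "300 * (N * \<epsilon> * \<eta>) \<le> \<eta>"
    using mult_right_mono[OF NE \<eta>] by (simp add: algebra_simps)
  have "- 16 * (N * \<epsilon> * \<eta>) \<le> S"
    using small S1 pos d(1) \<eta> by (cases "S \<le> \<eta>") (linarith, simp)
  then show "- 16 * CARD('n) * \<epsilon> * \<eta> \<le> (\<Sum>j\<in>UNIV. \<beta> j)"
    by (simp add: S_def N_def mult.assoc)
  show "\<eta> / 2 \<le> (\<Sum>j\<in>UNIV. \<beta> j)" if "\<eta> \<le> d"
    using small S1 pos2 that \<eta> unfolding S_def[symmetric]
    by (cases "S \<le> \<eta>") (linarith, simp)
qed

section \<open>Illuminating corner regions by beams\<close>

locale near_cube_with_deficit = supported_near_cube B \<epsilon> a r
  for B :: "(real ^ 'n) set" and \<epsilon> :: real and a r +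
  fixes z :: "real ^ 'n \<Rightarrow> real ^ 'n" and \<eta> :: real
  assumes z_in: "v \<in> sign_vectors \<Longrightarrow> z v \<in> B"
    and z_deficit: "v \<in> sign_vectors \<Longrightarrow> r k (v $ k) - a k (v $ k) \<bullet> z v \<le> \<eta>"
    and \<eta>: "0 \<le> \<eta>" "\<eta> \<le> 3 * \<epsilon>"
begin

text \<open>The 6 adds up the facet level (1), the slack \<eta> (3) and the off-diagonal part of the
  facet normal (2), in units of \<epsilon>.\<close>

lemma z_near:
  assumes v: "v \<in> sign_vectors"
  shows "1 - 6 * \<epsilon> \<le> v $ j * z v $ j"
  using inner_diff_diag_le[OF sign_vectors_cases[OF v], of "z v" j j] outer[OF z_in[OF v]]
    z_deficit[OF v, of j] r(1)[OF sign_vectors_cases[OF v], of j j] \<eta>(2)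
  by (simp add: abs_le_iff)

text \<open>The deviation \<open>b\<close> of \<nu> from the facet normal vanishes in coordinate
  \<open>i\<close>, and the beam is \<open>- v\<close> elsewhere. So \<open>b\<close> contributes
  exactly minus the sum estimated in \<open>weight_sum_bounds\<close>.\<close>

lemma corner_normal:
  assumes v: "v \<in> sign_vectors" and x: "x \<in> B" "\<And>j. 1 - 4 * \<epsilon> \<le> v $ j * x $ j"
    and \<nu>: "outer_normal B x \<nu>" "v $ i * \<nu> $ i = 1"
  shows "\<nu> \<bullet> beam v i s \<le> a i (v $ i) \<bullet> beam v i s + 16 * CARD('n) * \<epsilon> * \<eta>"
    and "\<eta> \<le> r i (v $ i) - a i (v $ i) \<bullet> x \<Longrightarrow>
         \<nu> \<bullet> beam v i s \<le> a i (v $ i) \<bullet> beam v i s - \<eta> / 2"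
proof -
  define \<sigma> where "\<sigma> = v $ i"
  have \<sigma>: "\<sigma> = 1 \<or> \<sigma> = -1" unfolding \<sigma>_def by (rule sign_vectors_cases[OF v])
  define b where "b = \<nu> - a i \<sigma>"
  define \<beta> where "\<beta> j = v $ j * b $ j" for j
  define d where "d = r i \<sigma> - a i \<sigma> \<bullet> x"
  have "\<nu> $ i = \<sigma>" using \<nu>(2) \<sigma> by (auto simp: \<sigma>_def[symmetric])
  then have bi: "b $ i = 0" by (simp add: b_def a_diag[OF \<sigma>])
  have vv: "v $ j * v $ j = 1" for j using sign_vectors_square[OF v] .
  have inner_b: "b \<bullet> y = (\<Sum>j\<in>UNIV. \<beta> j * (v $ j * y $ j))" for y
  proof -
    have "b $ j * y $ j = \<beta> j * (v $ j * y $ j)" for j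
      using vv[of j] by (simp add: \<beta>_def algebra_simps)
    then show ?thesis unfolding inner_vec_def inner_real_def by (intro sum.cong) auto
  qed
  have normal: "d - (r i \<sigma> - a i \<sigma> \<bullet> y) + b \<bullet> (y - x) \<le> 0" if "y \<in> B" for y
    using \<nu>(1) that by (auto simp: outer_normal_def b_def d_def inner_diff_left inner_diff_right)
  have d0: "0 \<le> d" using support[OF \<sigma> x(1)] by (simp add: d_def)
  \<comment> \<open>The normal inequality is tested at the contact point on the axis, where
    \<open>b\<close> vanishes.\<close>
  have "b \<bullet> axis i (\<sigma> * r i \<sigma>) = 0" by (simp add: inner_axis bi)
  moreover have "a i \<sigma> \<bullet> axis i (\<sigma> * r i \<sigma>) = r i \<sigma>"
    using \<sigma> by (auto simp: inner_axis a_diag[OF \<sigma>])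
  ultimately have "d \<le> b \<bullet> x"
    using normal[OF contact[OF \<sigma>, of i]] by (simp add: inner_diff_right)
  then have d1: "d \<le> (\<Sum>j\<in>UNIV. \<beta> j * (v $ j * x $ j))" by (simp add: inner_b)
  \<comment> \<open>Test the normal inequality at \<open>z (flip v j)\<close>. It lies at least 1
    behind \<open>x\<close> in signed coordinate \<open>j\<close> and within
    \<open>6 * \<epsilon>\<close> in the others, so a strongly negative \<open>\<beta> j\<close>
    would violate it.\<close>
  have neg: "- \<beta> j \<le> \<eta> + 6 * \<epsilon> * (\<Sum>k\<in>UNIV. \<bar>\<beta> k\<bar>)" if j: "\<beta> j < 0" for j
  proof -
    have ji: "j \<noteq> i" using j bi by (auto simp: \<beta>_def)
    let ?u = "flip v j"
    have u: "?u \<in> sign_vectors" using flip_in_sign_vectors[OF v] .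
    have "?u $ i = \<sigma>" using ji by (simp add: flip_component \<sigma>_def)
    then have "r i \<sigma> - a i \<sigma> \<bullet> z ?u \<le> \<eta>" using z_deficit[OF u, of i] by simp
    then have le: "- \<eta> \<le> b \<bullet> (x - z ?u)"
      using normal[OF z_in[OF u]] d0 by (simp add: inner_diff_right)
    have "b \<bullet> (x - z ?u) \<le> (\<Sum>k\<in>UNIV. 6 * \<epsilon> * \<bar>\<beta> k\<bar> + (if k = j then \<beta> j else 0))"
      unfolding inner_b
    proof (rule sum_mono)
      fix k
      have le1: "v $ k * x $ k \<le> 1" "?u $ k * z ?u $ k \<le> 1"
        using sign_coordinate_le[OF x(1) v] sign_coordinate_le[OF z_in[OF u] u] by auto
      have near: "1 - 6 * \<epsilon> \<le> ?u $ k * z ?u $ k" by (rule z_near[OF u])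
      show "\<beta> k * (v $ k * (x - z ?u) $ k) \<le> 6 * \<epsilon> * \<bar>\<beta> k\<bar> + (if k = j then \<beta> j else 0)"
      proof (cases "k = j")
        case True
        then have "1 \<le> v $ k * (x - z ?u) $ k"
          using near x(2)[of k] \<epsilon>_small by (simp add: flip_component algebra_simps)
        then have "\<beta> k * (v $ k * (x - z ?u) $ k) \<le> \<beta> k * 1"
          using True j by (intro mult_left_mono_neg) auto
        moreover have "0 \<le> 6 * \<epsilon> * \<bar>\<beta> k\<bar>" using \<epsilon> by simp
        ultimately show ?thesis using True by simp
      next
        case False
        then have "\<bar>v $ k * (x - z ?u) $ k\<bar> \<le> 6 * \<epsilon>"
          using near le1 x(2)[of k] \<epsilon> by (simp add: flip_component right_diff_distrib abs_le_iff)
        then have "\<bar>\<beta> k\<bar> * \<bar>v $ k * (x - z ?u) $ k\<bar> \<le> \<bar>\<beta> k\<bar> * (6 * \<epsilon>)"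
          by (intro mult_left_mono) auto
        then have "\<bar>\<beta> k * (v $ k * (x - z ?u) $ k)\<bar> \<le> 6 * \<epsilon> * \<bar>\<beta> k\<bar>"
          by (simp only: abs_mult mult.commute mult.left_commute)
        then show ?thesis using False by (simp only: if_False)
      qed
    qed
    also have "\<dots> = 6 * \<epsilon> * (\<Sum>k\<in>UNIV. \<bar>\<beta> k\<bar>) + \<beta> j"
      by (simp add: sum.distrib sum_distrib_left)
    finally show ?thesis using le by linarith
  qed
  have xi: "v $ j * x $ j \<le> 1" for j by (rule sign_coordinate_le[OF x(1) v])
  note bounds = weight_sum_bounds[of \<epsilon> "\<lambda>j. v $ j * x $ j" d \<beta> \<eta>,
      OF less_imp_le[OF \<epsilon>(1)] \<epsilon>(2) x(2) xi d0 d1 \<eta>(1) neg]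
  have "b \<bullet> beam v i s = - (\<Sum>j\<in>UNIV. \<beta> j)"
  proof -
    have "\<beta> j * (v $ j * beam v i s $ j) = - \<beta> j" for j
      using vv[of j] bi by (cases "j = i") (auto simp: beam_component \<beta>_def)
    then show ?thesis by (simp add: inner_b sum_negf)
  qed
  then have sum: "\<nu> \<bullet> beam v i s = a i \<sigma> \<bullet> beam v i s - (\<Sum>j\<in>UNIV. \<beta> j)"
    by (simp add: b_def inner_diff_left)
  show "\<nu> \<bullet> beam v i s \<le> a i (v $ i) \<bullet> beam v i s + 16 * CARD('n) * \<epsilon> * \<eta>"
    using bounds(1) unfolding sum \<sigma>_def[symmetric] by linarith
  show "\<nu> \<bullet> beam v i s \<le> a i (v $ i) \<bullet> beam v i s - \<eta> / 2"
    if "\<eta> \<le> r i (v $ i) - a i (v $ i) \<bullet> x"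
    using bounds(2) that unfolding sum \<sigma>_def[symmetric] d_def[symmetric] by linarith
qed

text \<open>A normal with \<open>v $ i * \<nu> $ i \<le> 0\<close> has negative product with the
  beam because it has one with \<open>- v\<close>; every other normal can be rescaled to fit
  \<open>corner_normal\<close>.\<close>

lemma illuminated_corner:
  assumes v: "v \<in> sign_vectors" and x: "x \<in> B" "\<And>j. 1 - 4 * \<epsilon> \<le> v $ j * x $ j"
    and s: "-1 \<le> s"
    and y: "a i (v $ i) \<bullet> beam v i s < - (16 * CARD('n) * \<epsilon> * \<eta>) \<or>
            \<eta> \<le> r i (v $ i) - a i (v $ i) \<bullet> x \<and> a i (v $ i) \<bullet> beam v i s < \<eta> / 2"
  shows "illuminated_in_direction B x (beam v i s)"
proof (rule illuminated_if_normals)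
  fix \<nu> assume \<nu>: "outer_normal B x \<nu>"
  have x0: "0 \<le> v $ j * x $ j" for j using x(2)[of j] \<epsilon>_small by linarith
  define c where "c = v $ i * \<nu> $ i"
  show "\<nu> \<bullet> beam v i s < 0"
  proof (cases "c > 0")
    case False
    have "0 < \<nu> \<bullet> v"
      using outer_normal_interior[OF \<nu> inward_half_step[OF x(1) v x0]]
      by (simp add: inner_diff_right)
    moreover have "(1 + s) * c \<le> 0" using s False by (intro mult_nonneg_nonpos) auto
    ultimately show ?thesis
      by (simp add: beam_eq inner_diff_right inner_axis c_def mult.commute mult.left_commute)
  next
    case True
    let ?\<nu> = "(1 / c) *\<^sub>R \<nu>"
    have "outer_normal B x ?\<nu>"
      using \<nu> True by (auto simp: outer_normal_def divide_right_mono)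
    moreover have "v $ i * ?\<nu> $ i = 1" using True by (auto simp: c_def)
    ultimately have "?\<nu> \<bullet> beam v i s < 0"
      using corner_normal[OF v x, of ?\<nu> i s] y by auto
    then show ?thesis using True by (simp add: divide_less_0_iff)
  qed
qed (use x convex_B interior_nonempty beam_nonzero[OF v card_ge_2] in auto)

text \<open>When the opposite facets \<open>i\<close> converge in direction \<open>v\<close>, one
  beam points inward from both of them, by a margin that beats the error in
  \<open>corner_normal\<close>.\<close>

lemma two_corners_at_once:
  assumes v: "v \<in> sign_vectors"
    and tilt: "32 * CARD('n) * \<epsilon> * \<eta> < (a i 1 + a i (-1)) \<bullet> v"
  shows "\<exists>D. illuminates D B \<and> card D \<le> 2 ^ CARD('n) - 1"
proof -
  define \<sigma> where "\<sigma> = v $ i"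
  have \<sigma>: "\<sigma> = 1 \<or> \<sigma> = -1" "- \<sigma> = 1 \<or> - \<sigma> = -1"
    unfolding \<sigma>_def using sign_vectors_cases[OF v, of i] by auto
  \<comment> \<open>This value, close to 0, equalises the products of the beam with the two facet
    normals; each becomes minus half the tilt along \<open>v\<close>.\<close>
  define s where "s = (a i \<sigma> \<bullet> v - a i (- \<sigma>) \<bullet> v) / 2 - 1"
  let ?w = "a i 1 + a i (-1)"
  have w: "?w \<bullet> v = a i \<sigma> \<bullet> v + a i (- \<sigma>) \<bullet> v" using \<sigma>(1) by (auto simp: inner_add_left)
  have v1: "\<bar>v $ j\<bar> \<le> 1" for j using sign_vectors_cases[OF v, of j] by auto
  have "\<sigma> * \<sigma> = 1" using \<sigma> by auto
  then have s1: "\<bar>s\<bar> \<le> 1"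
    using inner_diff_diag_le[OF \<sigma>(1), of v i, OF v1] inner_diff_diag_le[of "- \<sigma>" v i] v1 \<sigma> \<epsilon>_small
    unfolding s_def \<sigma>_def[symmetric] abs_le_iff by simp
  have b1: "a i \<sigma> \<bullet> beam v i s = - (?w \<bullet> v) / 2"
  proof -
    have "a i \<sigma> \<bullet> beam v i s = - (a i \<sigma> \<bullet> v) + (1 + s) * (\<sigma> * \<sigma>)"
      using inner_beam[OF \<sigma>(1), of i v s] by (simp add: \<sigma>_def[symmetric] mult.assoc)
    then show ?thesis unfolding w \<open>\<sigma> * \<sigma> = 1\<close> by (simp add: s_def field_simps)
  qed
  have b2: "a i (- \<sigma>) \<bullet> beam v i s = - (?w \<bullet> v) / 2"
  proof -
    have "a i (- \<sigma>) \<bullet> beam v i s = - (a i (- \<sigma>) \<bullet> v) - (1 + s) * (\<sigma> * \<sigma>)"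
      using inner_beam[OF \<sigma>(2), of i v s] by (simp add: \<sigma>_def[symmetric] mult.assoc)
    then show ?thesis unfolding w \<open>\<sigma> * \<sigma> = 1\<close> by (simp add: s_def field_simps)
  qed
  define V where "V = (sign_vectors :: (real ^ 'n) set)"
  \<comment> \<open>The beam takes the place of \<open>- v\<close>, and the direction of
    \<open>flip v i\<close> is dropped.\<close>
  define f where "f u = (if u = v then beam v i s else - u)" for u
  define D where "D = f ` (V - {flip v i})"
  have fin: "finite V" "card V = 2 ^ CARD('n)" unfolding V_def by (rule card_sign_vectors)+
  have fl: "flip v i \<in> V" unfolding V_def by (rule flip_in_sign_vectors[OF v])
  have "card D \<le> card (V - {flip v i})" unfolding D_def using fin by (intro card_image_le) auto
  then have card: "card D \<le> 2 ^ CARD('n) - 1" using fin fl by simp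
  have beam_D: "beam v i s \<in> D"
    using v flip_neq[OF v, of i] unfolding D_def V_def f_def by (auto intro!: image_eqI[of _ _ v])
  have opp_D: "- u \<in> D" if "u \<in> sign_vectors" "u \<noteq> v" "u \<noteq> flip v i" for u
    using that unfolding D_def V_def f_def by (auto intro!: image_eqI[of _ _ u])
  have "illuminates D B"
    unfolding illuminates_def
  proof (intro conjI ballI)
    show "finite D" using fin by (simp add: D_def)
    have "- u \<noteq> 0" if "u \<in> V" for u :: "real ^ 'n"
      using sign_vectors_cases[of u undefined] that unfolding V_def by force
    then show "0 \<notin> D" using beam_nonzero[OF v card_ge_2, of i s] unfolding D_def f_def by auto
    fix x assume "x \<in> frontier B"
    then have x: "x \<in> B" using compact_B compact_imp_closed frontier_subset_closed by blast
    define u where "u = sign_of x"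
    have u: "u \<in> sign_vectors" "\<And>j. 0 \<le> u $ j * x $ j"
      unfolding u_def by (auto simp: sign_of_in_sign_vectors sign_of_nonneg)
    show "\<exists>y\<in>D. illuminated_in_direction B x y"
    proof (cases "u = v \<or> u = flip v i")
      case False
      then show ?thesis using opp_D[OF u(1)] illuminated_by_opposite[OF x u] by blast
    next
      case uv: True
      \<comment> \<open>Seen from either end of the edge, the shared vector is a beam for the sign
        vector \<open>u\<close> of \<open>x\<close>.\<close>
      obtain s' where s': "beam v i s = beam u i s'" "\<bar>s'\<bar> \<le> 1"
      proof (cases "u = v")
        case True
        then show ?thesis using that[of s] s1 by simp
      next
        case False
        then show ?thesis using that[of "- s"] uv s1 by (simp add: beam_flip)
      qed
      have low: "a i (u $ i) \<bullet> beam u i s' < - (16 * CARD('n) * \<epsilon> * \<eta>)"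
        using uv b1 b2 tilt unfolding s'(1)[symmetric] by (auto simp: flip_component \<sigma>_def[symmetric])
      show ?thesis
      proof (cases "\<forall>j. 1 - 4 * \<epsilon> \<le> u $ j * x $ j")
        case True
        then have "illuminated_in_direction B x (beam u i s')"
          using illuminated_corner[OF u(1) x, of s' i] s'(2) low by auto
        then show ?thesis using beam_D s'(1) by metis
      next
        case False
        then obtain j where "u $ j * x $ j < 1 - 4 * \<epsilon>" by (auto simp: not_le)
        then have j: "\<bar>x $ j\<bar> < 1 - 4 * \<epsilon>"
          using u(2)[of j] sign_vectors_cases[OF u(1), of j] by auto
        show ?thesis
        proof (cases "j = i")
          case True
          then show ?thesis
            using illuminated_off_corner[OF x u s'(2), of i] j beam_D s'(1) by metis
        next
          case False
          \<comment> \<open>Crossing coordinate \<open>j\<close> leaves the special edge, so the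
            opposite direction of that vertex belongs to \<open>D\<close>.\<close>
          then have "flip u j \<noteq> v" "flip u j \<noteq> flip v i"
            using uv flip_flip_neq[OF v, of i j] flip_neq[OF v] injD[OF inj_flip[OF v]]
            by metis+
          then have "beam u j 1 \<in> D"
            unfolding beam_one by (intro opp_D flip_in_sign_vectors u)
          then show ?thesis using illuminated_off_corner[OF x u _ j, of 1] by auto
        qed
      qed
    qed
  qed
  then show ?thesis using card by blast
qed

text \<open>No direction is reserved for \<open>v\<close>: each neighbour gets a beam that still
  illuminates the neighbour's corner and also the points of the corner of \<open>v\<close> with
  slack at least \<eta> at the corresponding facet. By \<open>deep\<close> every point has such a
  facet.\<close>

lemma deep_corner_skipped:
  assumes v: "v \<in> sign_vectors" and \<eta>_pos: "0 < \<eta>"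
    and deep: "\<And>x. x \<in> B \<Longrightarrow> \<exists>k. \<eta> \<le> r k (v $ k) - a k (v $ k) \<bullet> x"
    and tilt: "\<And>i. \<bar>(a i 1 + a i (-1)) \<bullet> v\<bar> \<le> \<eta> / 8"
  shows "\<exists>D. illuminates D B \<and> card D \<le> 2 ^ CARD('n) - 1"
proof -
  have \<sigma>: "v $ i = 1 \<or> v $ i = -1" "- v $ i = 1 \<or> - v $ i = -1" for i
    using sign_vectors_cases[OF v, of i] by auto
  \<comment> \<open>Chosen so that the product with the facet normal at \<open>v\<close> is
    \<open>\<eta> / 4\<close>: outward, but below the allowance \<open>\<eta> / 2\<close> of
    \<open>illuminated_corner\<close>.\<close>
  define s where "s i = a i (v $ i) \<bullet> v - 1 + \<eta> / 4" for i
  have w: "(a i 1 + a i (-1)) \<bullet> v = a i (v $ i) \<bullet> v + a i (- v $ i) \<bullet> v" for i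
    using \<sigma>(1)[of i] by (auto simp: inner_add_left)
  have v1: "\<bar>v $ j\<bar> \<le> 1" for j using sign_vectors_cases[OF v, of j] by auto
  have vv: "v $ i * v $ i = 1" for i by (rule sign_vectors_square[OF v])
  have s1: "\<bar>s i\<bar> \<le> 1" for i
    using inner_diff_diag_le[OF \<sigma>(1), of v i i, OF v1] vv[of i] \<epsilon>_small \<eta>
    unfolding s_def abs_le_iff by simp
  have b1: "a i (v $ i) \<bullet> beam v i (s i) = \<eta> / 4" for i
    unfolding inner_beam[OF \<sigma>(1)] using vv[of i] by (simp add: s_def mult.assoc)
  have b2: "a i (- v $ i) \<bullet> beam v i (s i) = - (\<eta> / 4) - (a i 1 + a i (-1)) \<bullet> v" for i
    unfolding w using inner_beam[OF \<sigma>(2), of i i v "s i"] vv[of i] by (simp add: s_def mult.assoc)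
  \<comment> \<open>On the opposite facet the product is at most \<open>- \<eta> / 8\<close>, as the
    tilt costs no more than \<open>\<eta> / 8\<close>; this exceeds the error since 16/300 <
    1/8.\<close>
  have low: "a i (- v $ i) \<bullet> beam v i (s i) < - (16 * CARD('n) * \<epsilon> * \<eta>)" for i
  proof -
    have "300 * (CARD('n) * \<epsilon> * \<eta>) \<le> \<eta>"
      using mult_right_mono[OF \<epsilon>(2) \<eta>(1)] by (simp add: mult.assoc)
    then have "16 * (CARD('n) * \<epsilon> * \<eta>) < \<eta> / 8" using \<eta>_pos by simp
    then show ?thesis using b2[of i] tilt[of i] unfolding abs_le_iff by (simp add: mult.assoc)
  qed
  define V where "V = (sign_vectors :: (real ^ 'n) set)"
  \<comment> \<open>Neighbours of \<open>v\<close> are assigned their beams; all remaining vertices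
    keep \<open>- u\<close>.\<close>
  define f where "f u = (if u \<in> range (flip v)
    then let i = inv (flip v) u in beam v i (s i) else - u)" for u
  define D where "D = f ` (V - {v})"
  have fin: "finite V" "card V = 2 ^ CARD('n)" unfolding V_def by (rule card_sign_vectors)+
  have "card D \<le> card (V - {v})" unfolding D_def using fin by (intro card_image_le) auto
  then have card: "card D \<le> 2 ^ CARD('n) - 1" using fin v by (simp add: V_def)
  have f_flip: "f (flip v i) = beam v i (s i)" for i
    using inv_f_f[OF inj_flip[OF v]] by (simp add: f_def)
  have beam_D: "beam v i (s i) \<in> D" for i
    using flip_neq[OF v] flip_in_sign_vectors[OF v] unfolding D_def V_def
    by (auto simp: f_flip[symmetric])
  have opp_D: "- u \<in> D" if "u \<in> sign_vectors" "u \<noteq> v" "u \<notin> range (flip v)" for u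
    using that unfolding D_def V_def by (auto simp: f_def intro!: image_eqI[of _ _ u])
  have "illuminates D B"
    unfolding illuminates_def
  proof (intro conjI ballI)
    show "finite D" using fin by (simp add: D_def)
    have "- u \<noteq> 0" if "u \<in> V" for u :: "real ^ 'n"
      using sign_vectors_cases[of u undefined] that unfolding V_def by force
    then have "f u \<noteq> 0" if "u \<in> V" for u
      using beam_nonzero[OF v card_ge_2] that unfolding f_def Let_def by auto
    then show "0 \<notin> D" unfolding D_def by force
    fix x assume "x \<in> frontier B"
    then have x: "x \<in> B" using compact_B compact_imp_closed frontier_subset_closed by blast
    define u where "u = sign_of x"
    have u: "u \<in> sign_vectors" "\<And>j. 0 \<le> u $ j * x $ j"
      unfolding u_def by (auto simp: sign_of_in_sign_vectors sign_of_nonneg)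
    have small: "\<bar>x $ j\<bar> < 1 - 4 * \<epsilon>" if "u $ j * x $ j < 1 - 4 * \<epsilon>" for j
      using that u(2)[of j] sign_vectors_cases[OF u(1), of j] by auto
    consider "u = v" | i where "u = flip v i" | "u \<noteq> v" "u \<notin> range (flip v)" by blast
    then show "\<exists>y\<in>D. illuminated_in_direction B x y"
    proof cases
      case 1
      show ?thesis
      proof (cases "\<forall>j. 1 - 4 * \<epsilon> \<le> u $ j * x $ j")
        case True
        obtain k where "\<eta> \<le> r k (v $ k) - a k (v $ k) \<bullet> x" using deep[OF x] by blast
        then have "illuminated_in_direction B x (beam v k (s k))"
          using illuminated_corner[OF v x, of "s k" k] True s1[of k] b1[of k] \<eta>_pos 1 by auto
        then show ?thesis using beam_D by blast
      next
        case False
        then obtain j where "\<bar>x $ j\<bar> < 1 - 4 * \<epsilon>" using small not_le by blast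
        then show ?thesis using illuminated_off_corner[OF x u s1] beam_D 1 by blast
      qed
    next
      case (2 i)
      have bf: "beam u i (- s i) = beam v i (s i)" unfolding 2 beam_flip by simp
      show ?thesis
      proof (cases "\<forall>j. 1 - 4 * \<epsilon> \<le> u $ j * x $ j")
        case True
        have "a i (u $ i) \<bullet> beam u i (- s i) < - (16 * CARD('n) * \<epsilon> * \<eta>)"
          using low[of i] unfolding bf by (simp add: 2 flip_component)
        then have "illuminated_in_direction B x (beam u i (- s i))"
          using illuminated_corner[OF u(1) x, of "- s i" i] True s1[of i] by auto
        then show ?thesis using beam_D bf by metis
      next
        case False
        then obtain j where j: "\<bar>x $ j\<bar> < 1 - 4 * \<epsilon>" using small not_le by blast
        show ?thesis
        proof (cases "j = i")
          case True
          have "illuminated_in_direction B x (beam u i (- s i))"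
            using illuminated_off_corner[OF x u, of "- s i" i] s1[of i] j True by simp
          then show ?thesis using beam_D bf by metis
        next
          case False
          \<comment> \<open>This vertex is two flips away from \<open>v\<close>, so it has kept its
            own opposite direction.\<close>
          then have "flip u j \<noteq> v" "flip u j \<notin> range (flip v)"
            unfolding 2 using flip_flip_neq[OF v, of i j] by auto
          then have "beam u j 1 \<in> D"
            unfolding beam_one by (intro opp_D flip_in_sign_vectors u)
          then show ?thesis using illuminated_off_corner[OF x u _ j, of 1] by auto
        qed
      qed
    next
      case 3
      then show ?thesis using opp_D[OF u(1)] illuminated_by_opposite[OF x u] by blast
    qed
  qed
  then show ?thesis using card by blast
qed

end

section \<open>The dichotomy: parallelotope or a saved direction\<close>

context supported_near_cube
begin

text \<open>In facet coordinates the half-spaces bound an axis-parallel box. Zero slack puts all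
  vertices of the box into \<open>B\<close>, so convexity makes \<open>B\<close> the whole
  box.\<close>

lemma parallelotope_if_no_deficit:
  fixes z :: "real ^ 'n \<Rightarrow> real ^ 'n"
  assumes z: "\<And>v. v \<in> sign_vectors \<Longrightarrow> z v \<in> B"
    and deficit: "\<And>v k. v \<in> sign_vectors \<Longrightarrow> r k (v $ k) - a k (v $ k) \<bullet> z v \<le> 0"
    and parallel: "\<And>k. a k (-1) = - a k 1"
  shows "\<exists>T c. linear T \<and> bij T \<and> B = (\<lambda>z. T z + c) ` (cube_body :: (real ^ 'n) set)"
proof -
  define A where "A x = (\<chi> k. a k 1 \<bullet> x)" for x
  have linA: "linear A" by (simp add: linear_iff A_def vec_eq_iff inner_add_right)
  \<comment> \<open>Diagonal dominance: scale a kernel vector to maximum norm 1 and look at a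
    coordinate attaining it.\<close>
  have "inj A"
    unfolding linear_injective_0[OF linA]
  proof (intro allI impI, rule ccontr)
    fix x :: "real ^ 'n" assume Ax: "A x = 0" and "x \<noteq> 0"
    define m where "m = Max (range (\<lambda>j. \<bar>x $ j\<bar>))"
    have le: "\<bar>x $ j\<bar> \<le> m" for j unfolding m_def by (intro Max_ge) auto
    have "m \<in> range (\<lambda>j. \<bar>x $ j\<bar>)" unfolding m_def by (intro Max_in) auto
    then obtain i where i: "\<bar>x $ i\<bar> = m" by fast
    obtain j where "x $ j \<noteq> 0" using \<open>x \<noteq> 0\<close> by (auto simp: vec_eq_iff)
    then have m: "m > 0" using le[of j] by simp
    have "\<bar>a i 1 \<bullet> ((1 / m) *\<^sub>R x) - 1 * ((1 / m) *\<^sub>R x) $ i\<bar> \<le> 2 * \<epsilon>"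
      using le m by (intro inner_diff_diag_le) (auto simp: abs_mult)
    moreover have "a i 1 \<bullet> x = 0" using Ax by (simp add: A_def vec_eq_iff)
    ultimately show False using m i \<epsilon>_small by (simp add: abs_mult)
  qed
  then have bijA: "bij A" by (metis bij_betw_def linA linear_injective_imp_surjective)
  \<comment> \<open>Half-widths \<open>h\<close> and centre \<open>m\<close> of the box in facet
    coordinates.\<close>
  define h where "h k = (r k 1 + r k (-1)) / 2" for k
  define m where "m = (\<chi> k. (r k 1 - r k (-1)) / 2)"
  define H where "H x = (\<chi> k. h k * x $ k)" for x :: "real ^ 'n"
  have h: "h k > 0" for k using r(1)[of 1 k] r(1)[of "-1" k] \<epsilon>_small by (simp add: h_def)
  have linH: "linear H" by (simp add: linear_iff H_def vec_eq_iff algebra_simps)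
  have bijH: "bij H"
    by (rule o_bij[of "\<lambda>x. \<chi> k. x $ k / h k"])
      (use h in \<open>auto simp: H_def fun_eq_iff vec_eq_iff less_imp_neq[THEN not_sym]\<close>)
  define T where "T = inv A \<circ> H"
  have A_inv: "A (inv A y) = y" for y using bijA by (simp add: bij_is_surj surj_f_inv_f)
  have inv_A: "inv A (A y) = y" for y using bijA by (simp add: bij_is_inj)
  have "linear (inv A)" using linA bijA by (simp add: linear_iff) (metis A_inv inv_A)
  then have linT: "linear T" unfolding T_def using linH by (rule linear_compose[rotated])
  have bijT: "bij T" unfolding T_def using bijA bijH by (simp add: bij_comp bij_imp_bij_inv)
  define c where "c = inv A m"
  have image: "A (T y + c) = H y + m" for y
    by (simp add: T_def c_def linear_add[OF linA] A_inv)
  have "B = (\<lambda>y. T y + c) ` (cube_body :: (real ^ 'n) set)"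
  proof
    show "B \<subseteq> (\<lambda>y. T y + c) ` cube_body"
    proof
      fix x assume x: "x \<in> B"
      define y where "y = (\<chi> k. (a k 1 \<bullet> x - m $ k) / h k)"
      have "A (T y + c) = A x"
        using h unfolding image
        by (auto simp: A_def H_def y_def vec_eq_iff less_imp_neq[THEN not_sym])
      then have "x = T y + c" by (metis inv_A)
      moreover have "y \<in> cube_body"
        unfolding cube_body_def mem_box_cart
      proof
        fix k
        have "a k 1 \<bullet> x \<le> r k 1" "- (a k 1 \<bullet> x) \<le> r k (-1)"
          using support[OF _ x, of 1 k] support[OF _ x, of "-1" k] by (auto simp: parallel)
        then have "- h k \<le> a k 1 \<bullet> x - m $ k" "a k 1 \<bullet> x - m $ k \<le> h k"
          by (simp_all add: h_def m_def field_simps)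
        then show "(- 1) $ k \<le> y $ k \<and> y $ k \<le> 1 $ k"
          using h[of k] by (simp add: y_def pos_le_divide_eq pos_divide_le_eq)
      qed
      ultimately show "x \<in> (\<lambda>y. T y + c) ` cube_body" by blast
    qed
    have "convex {y. T y + c \<in> B}"
    proof -
      have "{y. T y + c \<in> B} = T -` ((+) (- c) ` B)" by (force simp: image_iff)
      then show ?thesis using convex_linear_vimage[OF linT] convex_translation[OF convex_B] by metis
    qed
    moreover have "sign_vectors \<subseteq> {y. T y + c \<in> B}"
    proof
      fix v :: "real ^ 'n" assume v: "v \<in> sign_vectors"
      have "a k 1 \<bullet> z v = h k * v $ k + m $ k" for k
        using sign_vectors_cases[OF v, of k] deficit[OF v, of k] support[OF _ z[OF v], of "v $ k" k]
        by (auto simp: h_def m_def parallel field_simps)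
      then have "A (T v + c) = A (z v)"
        unfolding image by (simp add: A_def H_def vec_eq_iff)
      then have "T v + c = z v" by (metis inv_A)
      then show "v \<in> {y. T y + c \<in> B}" using z[OF v] by simp
    qed
    ultimately have "cube_body \<subseteq> {y. T y + c \<in> B}"
      unfolding cube_body_def by (rule cube_subset_convex)
    then show "(\<lambda>y. T y + c) ` cube_body \<subseteq> B" by auto
  qed
  then show ?thesis using linT bijT by (intro exI[of _ T] exI[of _ c] conjI)
qed

text \<open>On \<open>B\<close> all slacks are nonnegative, so this is the largest slack at the
  facets of \<open>v\<close>; the norm makes continuity immediate.\<close>

definition deficit :: "real ^ 'n \<Rightarrow> real ^ 'n \<Rightarrow> real" where
  "deficit v x = infnorm (\<chi> k. r k (v $ k) - a k (v $ k) \<bullet> x)"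

lemma deficit_ge: "r k (v $ k) - a k (v $ k) \<bullet> x \<le> deficit v x"
  using component_le_infnorm_cart[of "\<chi> k. r k (v $ k) - a k (v $ k) \<bullet> x" k]
  by (simp add: deficit_def)

lemma deficit_attained:
  assumes "v \<in> sign_vectors" "x \<in> B"
  obtains k where "deficit v x = r k (v $ k) - a k (v $ k) \<bullet> x"
proof -
  let ?d = "\<chi> k. r k (v $ k) - a k (v $ k) \<bullet> x"
  have "deficit v x \<in> (\<lambda>i. \<bar>?d \<bullet> i\<bar>) ` Basis"
    unfolding deficit_def infnorm_Max by (intro Max_in) auto
  then obtain k where "deficit v x = \<bar>?d $ k\<bar>"
    by (auto simp: Basis_vec_def inner_axis)
  moreover have "0 \<le> ?d $ k" using support[OF sign_vectors_cases[OF assms(1)] assms(2)] by simp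
  ultimately show thesis using that by simp
qed

lemma deficit_minimum:
  assumes v: "v \<in> sign_vectors"
  obtains x where "x \<in> B" "\<And>y. y \<in> B \<Longrightarrow> deficit v x \<le> deficit v y" "deficit v x \<le> 3 * \<epsilon>"
proof -
  have "continuous_on B (deficit v)"
    unfolding deficit_def by (intro continuous_intros)
  moreover have "B \<noteq> {}" using interior_nonempty interior_subset by fastforce
  ultimately obtain x where x: "x \<in> B" "\<And>y. y \<in> B \<Longrightarrow> deficit v x \<le> deficit v y"
    using continuous_attains_inf[OF compact_B] by blast
  \<comment> \<open>The inner cube's vertex has slack at most \<open>3 * \<epsilon>\<close>:
    \<epsilon> from scaling and \<open>2 * \<epsilon>\<close> from off-diagonal entries.\<close>
  let ?y = "(1 - \<epsilon>) *\<^sub>R v"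
  have y: "?y \<in> B"
  proof (rule inner)
    show "\<bar>?y $ j\<bar> \<le> 1 - \<epsilon>" for j using sign_vectors_cases[OF v, of j] \<epsilon>_small by auto
  qed
  obtain k where k: "deficit v ?y = r k (v $ k) - a k (v $ k) \<bullet> ?y"
    using deficit_attained[OF v y] .
  have "v $ k * ?y $ k = 1 - \<epsilon>"
    using sign_vectors_square[OF v, of k] by simp
  moreover have "\<bar>a k (v $ k) \<bullet> ?y - v $ k * ?y $ k\<bar> \<le> 2 * \<epsilon>"
    by (rule inner_diff_diag_le[OF sign_vectors_cases[OF v] outer[OF y]])
  moreover have "r k (v $ k) \<le> 1" by (rule r(2)[OF sign_vectors_cases[OF v]])
  ultimately have "deficit v ?y \<le> 3 * \<epsilon>" unfolding k by linarith
  then show thesis using that[OF x] x(2)[OF y] by linarith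
qed

lemma parallelotope_or_illuminated_if_supported:
  "(\<exists>T c. linear T \<and> bij T \<and> B = (\<lambda>z. T z + c) ` (cube_body :: (real ^ 'n) set)) \<or>
   (\<exists>D. illuminates D B \<and> card D \<le> 2 ^ CARD('n) - 1)"
proof -
  have "\<exists>z. \<forall>v\<in>sign_vectors. z v \<in> B \<and> (\<forall>y\<in>B. deficit v (z v) \<le> deficit v y) \<and> deficit v (z v) \<le> 3 * \<epsilon>"
    by (intro bchoice ballI) (metis deficit_minimum)
  then obtain z where z: "\<And>v. v \<in> sign_vectors \<Longrightarrow> z v \<in> B"
    "\<And>v y. v \<in> sign_vectors \<Longrightarrow> y \<in> B \<Longrightarrow> deficit v (z v) \<le> deficit v y"
    "\<And>v. v \<in> sign_vectors \<Longrightarrow> deficit v (z v) \<le> 3 * \<epsilon>"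
    by blast
  let ?E = "(\<lambda>v. deficit v (z v)) ` sign_vectors"
  have fin: "finite ?E" "?E \<noteq> {}"
    using card_sign_vectors(1) sign_of_in_sign_vectors by auto
  \<comment> \<open>A maximum of minima: it bounds the slacks of every \<open>z v\<close>, yet at
    the maximising \<open>v\<close> no point of \<open>B\<close> does better.\<close>
  define \<eta> where "\<eta> = Max ?E"
  have le: "deficit v (z v) \<le> \<eta>" if "v \<in> sign_vectors" for v
    unfolding \<eta>_def using fin that by (intro Max_ge) auto
  obtain v where v: "v \<in> sign_vectors" "\<eta> = deficit v (z v)"
    using Max_in[OF fin] unfolding \<eta>_def by auto
  have \<eta>: "0 \<le> \<eta>" "\<eta> \<le> 3 * \<epsilon>"
    using z(3)[OF v(1)] unfolding v(2) by (auto simp: deficit_def infnorm_pos_le)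
  interpret near_cube_with_deficit B \<epsilon> a r z \<eta>
  proof
    show "r k (u $ k) - a k (u $ k) \<bullet> z u \<le> \<eta>" if "u \<in> sign_vectors" for u k
      using deficit_ge le[OF that] by (rule order_trans)
  qed (use z(1) \<eta> in auto)
  let ?w = "\<lambda>i. a i 1 + a i (-1)"
  show ?thesis
  proof (cases "\<exists>u\<in>sign_vectors. \<exists>i. 32 * CARD('n) * \<epsilon> * \<eta> < ?w i \<bullet> u")
    case True
    then show ?thesis using two_corners_at_once by blast
  next
    case False
    then have tilt: "?w i \<bullet> u \<le> 32 * CARD('n) * \<epsilon> * \<eta>" if "u \<in> sign_vectors" for u i
      by (meson False linorder_not_less that)
    have neg: "- u \<in> sign_vectors" if "u \<in> sign_vectors" for u :: "real ^ 'n"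
      using that by (force simp: sign_vectors_def)
    show ?thesis
    proof (cases "\<eta> = 0")
      case True
      have "a i (-1) = - a i 1" for i
      proof -
        \<comment> \<open>Testing the tilt against its own sign vector yields its 1-norm, so the
          bound 0 makes it vanish.\<close>
        have "?w i \<bullet> sign_of (?w i) = (\<Sum>j\<in>UNIV. \<bar>?w i $ j\<bar>)"
          unfolding inner_vec_def by (intro sum.cong) (auto simp: sign_of_def)
        then have "(\<Sum>j\<in>UNIV. \<bar>?w i $ j\<bar>) \<le> 0"
          using tilt[OF sign_of_in_sign_vectors, of i "?w i"] True by simp
        then have "(\<Sum>j\<in>UNIV. \<bar>?w i $ j\<bar>) = 0" by (intro antisym sum_nonneg) auto
        then have "?w i = 0" by (simp add: sum_nonneg_eq_0_iff vec_eq_iff)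
        then show ?thesis by (simp add: eq_neg_iff_add_eq_0 add.commute)
      qed
      moreover have "r k (u $ k) - a k (u $ k) \<bullet> z u \<le> 0" if "u \<in> sign_vectors" for u k
        using z_deficit[OF that] True by simp
      ultimately show ?thesis using parallelotope_if_no_deficit[of z] z(1) by blast
    next
      case pos: False
      \<comment> \<open>As 32/300 < 1/8, failing the first case at both \<open>v\<close> and
        \<open>- v\<close> gives the two-sided tilt bound.\<close>
      have "32 * CARD('n) * \<epsilon> * \<eta> \<le> \<eta> / 8"
        using mult_right_mono[OF \<epsilon>(2) \<eta>(1)] \<eta>(1) by (simp add: mult.assoc)
      then have "\<bar>?w i \<bullet> v\<bar> \<le> \<eta> / 8" for i
        using tilt[OF v(1), of i] tilt[OF neg[OF v(1)], of i] by (simp add: abs_le_iff)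
      moreover have "\<exists>k. \<eta> \<le> r k (v $ k) - a k (v $ k) \<bullet> x" if "x \<in> B" for x
        using deficit_attained[OF v(1) that] z(2)[OF v(1) that] v(2) by metis
      ultimately show ?thesis using deep_corner_skipped[OF v(1)] pos \<eta>(1) by simp
    qed
  qed
qed

end

context near_cube
begin

lemma parallelotope_or_illuminated:
  "(\<exists>T c. linear T \<and> bij T \<and> B = (\<lambda>z. T z + c) ` (cube_body :: (real ^ 'n) set)) \<or>
   (\<exists>D. illuminates D B \<and> card D \<le> 2 ^ CARD('n) - 1)"
proof -
  define P where "P k \<sigma> = (\<lambda>(a :: real ^ 'n, r). a $ k = \<sigma> \<and> (\<Sum>j\<in>UNIV - {k}. \<bar>a $ j\<bar>) \<le> 2 * \<epsilon> \<and>
    1 - \<epsilon> \<le> r \<and> r \<le> 1 \<and> axis k (\<sigma> * r) \<in> B \<and> (\<forall>z\<in>B. a \<bullet> z \<le> r))" for k \<sigma>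
  define p where "p k \<sigma> = (SOME q. P k \<sigma> q)" for k \<sigma>
  have "P k \<sigma> (p k \<sigma>)" if "\<sigma> = 1 \<or> \<sigma> = -1" for k \<sigma>
  proof -
    have "\<exists>q. P k \<sigma> q" using support_on_axis[OF that, of k] by (force simp: P_def)
    then show ?thesis unfolding p_def by (rule someI_ex)
  qed
  then interpret supported_near_cube B \<epsilon> "\<lambda>k \<sigma>. fst (p k \<sigma>)" "\<lambda>k \<sigma>. snd (p k \<sigma>)"
    by unfold_locales (simp_all add: P_def case_prod_beta)
  show ?thesis by (rule parallelotope_or_illuminated_if_supported)
qed

end

section \<open>Banach--Mazur distance to the cube\<close>

lemma banach_mazur_dist_affine_cube:
  fixes B :: "(real ^ 'n) set"
  assumes "linear T" "bij T" "B = (\<lambda>z. T z + c) ` (cube_body :: (real ^ 'n) set)"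
  shows "banach_mazur_dist B cube_body = 1"
  unfolding banach_mazur_dist_def
proof (rule cInf_eq_minimum)
  show "1 \<in> {l. 1 \<le> l \<and> (\<exists>T x y. linear T \<and> bij T \<and>
            B \<subseteq> (\<lambda>z. T z + x) ` (cube_body :: (real ^ 'n) set) \<and>
            (\<lambda>z. T z + x) ` cube_body \<subseteq> (\<lambda>z. l *\<^sub>R z + y) ` B)}"
    unfolding mem_Collect_eq
    by (intro conjI exI[of _ T] exI[of _ c] exI[of _ 0]) (use assms in auto)
qed auto

text \<open>The infimum over an empty set would carry no information. A large cube contains
  \<open>B\<close>, and a large dilate of a ball inside \<open>B\<close> contains that cube.\<close>

lemma banach_mazur_set_nonempty:
  fixes B :: "(real ^ 'n) set"
  assumes "convex_body B"
  shows "{l. 1 \<le> l \<and> (\<exists>T x y. linear T \<and> bij T \<and>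
            B \<subseteq> (\<lambda>z. T z + x) ` (cube_body :: (real ^ 'n) set) \<and>
            (\<lambda>z. T z + x) ` cube_body \<subseteq> (\<lambda>z. l *\<^sub>R z + y) ` B)} \<noteq> {}"
proof -
  obtain R where R: "R > 0" "\<And>x. x \<in> B \<Longrightarrow> norm x \<le> R"
    using assms compact_imp_bounded bounded_pos unfolding convex_body_def by metis
  obtain p e where e: "e > 0" "cball p e \<subseteq> B"
    using assms mem_interior_cball unfolding convex_body_def by blast
  obtain C where C: "\<And>u :: real ^ 'n. u \<in> cube_body \<Longrightarrow> norm u \<le> C"
    using bounded_cbox bounded_iff unfolding cube_body_def by metis
  define l where "l = max 1 (R * C / e)"
  have l: "1 \<le> l" "R * C \<le> l * e"
    using e(1) by (auto simp: l_def pos_divide_le_eq[symmetric])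
  let ?T = "\<lambda>z :: real ^ 'n. R *\<^sub>R z"
  have "linear ?T" by (simp add: linear_iff algebra_simps)
  moreover have "bij ?T"
    by (rule o_bij[of "\<lambda>z. (1 / R) *\<^sub>R z"]) (use R in \<open>auto simp: fun_eq_iff\<close>)
  moreover have "B \<subseteq> (\<lambda>z. ?T z + 0) ` cube_body"
  proof
    fix x assume x: "x \<in> B"
    have "(1 / R) *\<^sub>R x \<in> cube_body"
      unfolding cube_body_def mem_box_cart
    proof
      fix j
      have "\<bar>x $ j\<bar> \<le> R" using component_le_norm_cart[of x j] R(2)[OF x] by linarith
      then show "(- 1) $ j \<le> ((1 / R) *\<^sub>R x) $ j \<and> ((1 / R) *\<^sub>R x) $ j \<le> 1 $ j"
        using R(1) by (simp add: abs_le_iff pos_le_divide_eq pos_divide_le_eq)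
    qed
    then show "x \<in> (\<lambda>z. ?T z + 0) ` cube_body" using R by (force simp: image_iff)
  qed
  moreover have "(\<lambda>z. ?T z + 0) ` cube_body \<subseteq> (\<lambda>z. l *\<^sub>R z + (- l *\<^sub>R p)) ` B"
  proof (clarify, simp only: add_0_right)
    fix u :: "real ^ 'n" assume "u \<in> cube_body"
    then have "norm (R *\<^sub>R u) \<le> R * C" using C R by (simp add: mult_left_mono)
    then have "norm ((1 / l) *\<^sub>R R *\<^sub>R u) \<le> e"
      using l by (simp add: pos_divide_le_eq mult.commute)
    then have "p + (1 / l) *\<^sub>R R *\<^sub>R u \<in> B" using e(2) by (auto simp: dist_norm)
    moreover have "R *\<^sub>R u = l *\<^sub>R (p + (1 / l) *\<^sub>R R *\<^sub>R u) + (- l *\<^sub>R p)"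
      using l by (simp add: algebra_simps)
    ultimately show "R *\<^sub>R u \<in> (\<lambda>z. l *\<^sub>R z + (- l *\<^sub>R p)) ` B" by blast
  qed
  ultimately show ?thesis
    unfolding ex_in_conv[symmetric] mem_Collect_eq using l(1)
    by (intro exI[of _ l] conjI exI[of _ ?T] exI[of _ 0] exI[of _ "- l *\<^sub>R p"])
qed

text \<open>Covering leaves little freedom for the translation \<open>y\<close>, so shrinking the
  cube slightly more compensates for both factor and shift.\<close>

lemma near_cube_if_dilate_covers:
  fixes B :: "(real ^ 'n) set"
  assumes "convex B" "compact B" and sub: "B \<subseteq> cube_body" and l: "1 \<le> l" "l \<le> 1 + \<epsilon> / 2"
    and cover: "cube_body \<subseteq> (\<lambda>z. l *\<^sub>R z + y) ` B"
    and \<epsilon>: "0 < \<epsilon>" "300 * real CARD('n) * \<epsilon> \<le> 1" and "CARD('n) \<ge> 2"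
  shows "near_cube B \<epsilon>"
proof
  have outer: "\<bar>x $ j\<bar> \<le> 1" if "x \<in> B" for x j
    using that sub unfolding cube_body_def by (force simp: mem_box_cart abs_le_iff minus_le_iff)
  then show "\<And>x j. x \<in> B \<Longrightarrow> \<bar>x $ j\<bar> \<le> 1" .
  have in_cube: "x \<in> cube_body" if "\<And>j. \<bar>x $ j\<bar> \<le> 1" for x :: "real ^ 'n"
    using that unfolding cube_body_def by (auto simp: mem_box_cart abs_le_iff minus_le_iff)
  \<comment> \<open>The dilate must reach both opposite vertices 1 and -1, while
    \<open>l *\<^sub>R z\<close> has coordinates of absolute value at most \<open>l\<close>.\<close>
  have yj: "\<bar>y $ j\<bar> \<le> l - 1" for j
  proof -
    have "\<exists>z\<in>B. x = l *\<^sub>R z + y" if "x \<in> cube_body" for x using cover that by blast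
    moreover have "1 \<in> (cube_body :: (real ^ 'n) set)" "-1 \<in> (cube_body :: (real ^ 'n) set)"
      by (auto intro!: in_cube)
    ultimately obtain z z' where z: "z \<in> B" "1 = l *\<^sub>R z + y" "z' \<in> B" "-1 = l *\<^sub>R z' + y" by metis
    have "1 = l * z $ j + y $ j" "-1 = l * z' $ j + y $ j"
      using arg_cong[OF z(2), of "\<lambda>w. w $ j"] arg_cong[OF z(4), of "\<lambda>w. w $ j"] by simp_all
    moreover have "l * z $ j \<le> l * 1" "l * (-1) \<le> l * z' $ j"
      using outer[OF z(1), of j] outer[OF z(3), of j] l(1) by (intro mult_left_mono; simp)+
    ultimately show ?thesis unfolding abs_le_iff by linarith
  qed
  show "x \<in> B" if x: "\<And>j. \<bar>x $ j\<bar> \<le> 1 - \<epsilon>" for x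
  proof -
    \<comment> \<open>The factor costs \<open>l - 1\<close> and the shift another
      \<open>l - 1\<close>; together at most \<epsilon>, which explains the bound
      \<open>1 + \<epsilon> / 2\<close> on \<open>l\<close>.\<close>
    have "l *\<^sub>R x + y \<in> cube_body"
    proof (rule in_cube)
      fix j
      have "\<bar>l * x $ j\<bar> \<le> l * (1 - \<epsilon>)"
        using x[of j] l(1) by (simp add: abs_mult)
      moreover have "l * \<epsilon> \<ge> 1 * \<epsilon>" using l \<epsilon> by (intro mult_right_mono) auto
      ultimately have "\<bar>l * x $ j\<bar> \<le> 1 - (l - 1)" using l(2) by (simp add: right_diff_distrib)
      then show "\<bar>(l *\<^sub>R x + y) $ j\<bar> \<le> 1" using yj[of j] by simp
    qed
    then obtain z where "z \<in> B" "l *\<^sub>R x + y = l *\<^sub>R z + y" using cover by blast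
    then show "x \<in> B" using l by simp
  qed
qed (use assms in auto)

theorem theorem1:
  assumes "CARD('n::finite) \<ge> 3"
  shows "\<exists>\<delta>::real. \<delta> > 0 \<and>
    (\<forall>B :: (real ^ 'n) set.
       convex_body B \<and> banach_mazur_dist B cube_body \<noteq> 1 \<and>
       banach_mazur_dist B cube_body \<le> 1 + \<delta> \<longrightarrow>
       illumination_number B \<le> enat (2 ^ CARD('n) - 1))"
proof -
  define \<epsilon> where "\<epsilon> = 1 / (300 * real CARD('n))"
  have \<epsilon>: "0 < \<epsilon>" "300 * real CARD('n) * \<epsilon> \<le> 1" by (auto simp: \<epsilon>_def)
  have "illumination_number B \<le> enat (2 ^ CARD('n) - 1)"
    if B: "convex_body B" and d: "banach_mazur_dist B cube_body \<noteq> 1"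
      "banach_mazur_dist B cube_body \<le> 1 + \<epsilon> / 4" for B :: "(real ^ 'n) set"
  proof -
    \<comment> \<open>The infimum need not be attained; the gap between
      \<open>\<epsilon> / 4\<close> and \<open>\<epsilon> / 2\<close> provides an admissible
      \<open>l\<close>.\<close>
    have "banach_mazur_dist B cube_body < 1 + \<epsilon> / 2" using d(2) \<epsilon> by simp
    from cInf_lessD[OF banach_mazur_set_nonempty[OF B] this[unfolded banach_mazur_dist_def]]
    obtain l T x y where l: "1 \<le> l" "l < 1 + \<epsilon> / 2" and T: "linear T" "bij T"
      and sub: "B \<subseteq> (\<lambda>z. T z + x) ` (cube_body :: (real ^ 'n) set)"
      and cover: "(\<lambda>z. T z + x) ` cube_body \<subseteq> (\<lambda>z. l *\<^sub>R z + y) ` B"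
      by blast
    define S where "S = inv T"
    have TS: "T (S z) = z" and ST: "S (T z) = z" for z
      using T(2) by (simp_all add: S_def bij_is_surj surj_f_inv_f bij_is_inj)
    have S: "linear S" using T by (simp add: linear_iff) (metis TS ST)
    define C where "C = (\<lambda>z. S z + S (- x)) ` B"
    have BC: "B = (\<lambda>z. T z + x) ` C"
      by (force simp: C_def image_image linear_add[OF T(1)] TS)
    have "near_cube C \<epsilon>"
    proof (rule near_cube_if_dilate_covers)
      have C_eq: "C = (+) (S (- x)) ` (S ` B)" by (auto simp: C_def image_image add.commute)
      show "convex C" unfolding C_eq
        using B S by (simp add: convex_body_def convex_linear_image convex_translation)
      show "compact C" unfolding C_eq
        using B compact_continuous_image[OF linear_continuous_on_compose[OF continuous_on_id S]]
        by (simp add: convex_body_def compact_translation)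
      show "C \<subseteq> cube_body"
      proof
        fix w assume "w \<in> C"
        then have "T w + x \<in> B" using BC by blast
        then obtain q where "q \<in> cube_body" "T w + x = T q + x" using sub by blast
        then show "w \<in> cube_body" using ST by (metis add_right_cancel)
      qed
      \<comment> \<open>Pulling the covering back by the affine map: its translation
        \<open>x\<close> is scaled by \<open>l\<close> on one side only, which adds
        \<open>l - 1\<close> times \<open>x\<close> to \<open>y\<close>.\<close>
      let ?y = "S ((l - 1) *\<^sub>R x + y)"
      show "cube_body \<subseteq> (\<lambda>z. l *\<^sub>R z + ?y) ` C"
      proof
        fix q :: "real ^ 'n" assume "q \<in> cube_body"
        then obtain b where b: "b \<in> B" "T q + x = l *\<^sub>R b + y" using cover by blast
        then obtain w where w: "w \<in> C" "b = T w + x" using BC by blast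
        have "T q = l *\<^sub>R T w + ((l - 1) *\<^sub>R x + y)"
          using b(2) w(2) by (simp add: algebra_simps)
        then have "S (T q) = l *\<^sub>R S (T w) + ?y"
          by (simp only: linear_add[OF S] linear_scale[OF S])
        then show "q \<in> (\<lambda>z. l *\<^sub>R z + ?y) ` C" using w(1) ST by auto
      qed
    qed (use l \<epsilon> assms in auto)
    then interpret near_cube C \<epsilon> .
    show ?thesis
    proof (cases "\<exists>T' c. linear T' \<and> bij T' \<and> C = (\<lambda>z. T' z + c) ` (cube_body :: (real ^ 'n) set)")
      case True
      then obtain T' c where T': "linear T'" "bij T'" "C = (\<lambda>z. T' z + c) ` (cube_body :: (real ^ 'n) set)" by blast
      \<comment> \<open>An affine image of the cube is at distance 1, which the hypothesis
        excludes.\<close>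
      have "B = (\<lambda>z. (T \<circ> T') z + (T c + x)) ` cube_body"
        unfolding BC T'(3) image_image by (simp add: linear_add[OF T(1)] add.assoc)
      then have "banach_mazur_dist B cube_body = 1"
        using banach_mazur_dist_affine_cube linear_compose[OF T'(1) T(1)] bij_comp[OF T'(2) T(2)]
        by blast
      then show ?thesis using d(1) by contradiction
    next
      case False
      then obtain D where D: "illuminates D C" "card D \<le> 2 ^ CARD('n) - 1"
        using parallelotope_or_illuminated by blast
      have "illuminates (T ` D) B"
        unfolding BC by (rule illuminates_affine_image[OF T D(1)])
      then have "illumination_number B \<le> enat (card (T ` D))"
        unfolding illumination_number_def by (intro INF_lower) simp
      also have "\<dots> \<le> enat (2 ^ CARD('n) - 1)"
        using card_image_le[of D T] D by (simp add: illuminates_def)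
      finally show ?thesis .
    qed
  qed
  then show ?thesis using \<epsilon> by (intro exI[of _ "\<epsilon> / 4"]) simp
qed

end
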